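(* Let $n\ge2$, let $\Sigma\subset\mathbb{R}^n$ be a $C^2$ hypersurface and $\varepsilon>0$. Then for every $R\ge C_{\Sigma,\varepsilon}$ there is a $C^2$ hypersurface $\Sigma'_R$ within $\varepsilon$ of $\Sigma$ in the $C^2$ topology which contains at least $c_{\Sigma,\varepsilon}R^{n-2+\frac{2}{n+1}}$ points of the lattice $(\tfrac1R\mathbb{Z})^n$, where $C_{\Sigma,\varepsilon},c_{\Sigma,\varepsilon}>0$ depend only on $\Sigma,\varepsilon$ (and $n$). *)

theory Defs
  imports "HOL-Analysis.Analysis"
begin

definition is_C2_on ::
  "'a::real_normed_vector set \<Rightarrow> ('a \<Rightarrow> 'b::real_normed_vector) \<Rightarrow> ('a \<Rightarrow> 'a \<Rightarrow>\<^sub>L 'b)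
    \<Rightarrow> ('a \<Rightarrow> 'a \<Rightarrow>\<^sub>L 'a \<Rightarrow>\<^sub>L 'b) \<Rightarrow> bool" where
  "is_C2_on U f f' f'' \<longleftrightarrow>
     (\<forall>x\<in>U. (f has_derivative blinfun_apply (f' x)) (at x)) \<and>
     (\<forall>x\<in>U. (f' has_derivative blinfun_apply (f'' x)) (at x)) \<and>
     continuous_on U f''"

definition c2_hypersurface :: "(real^'n) set \<Rightarrow> bool" where
  "c2_hypersurface S \<longleftrightarrow>
     (\<forall>p\<in>S. \<exists>U (\<phi>::real^'n \<Rightarrow> real) \<phi>' \<phi>''.
        open U \<and> p \<in> U \<and> is_C2_on U \<phi> \<phi>' \<phi>'' \<and> (\<forall>x\<in>U. \<phi>' x \<noteq> 0) \<and>
        S \<inter> U = {x\<in>U. \<phi> x = 0})"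

definition c2_close :: "(real^'n) set \<Rightarrow> (real^'n) set \<Rightarrow> real \<Rightarrow> bool" where
  "c2_close S S' \<epsilon> \<longleftrightarrow>
     (\<exists>g g' g'' h h' h''. is_C2_on UNIV g g' g'' \<and> is_C2_on UNIV h h' h'' \<and>
        (\<forall>x. h (g x) = x \<and> g (h x) = x) \<and> S' = g ` S \<and>
        (\<exists>\<delta><\<epsilon>. \<forall>x\<in>S. norm (g x - x) \<le> \<delta> \<and> norm (g' x - id_blinfun) \<le> \<delta> \<and>
                          norm (g'' x) \<le> \<delta>))"

definition scaled_lattice :: "real \<Rightarrow> (real^'n) set" where
  "scaled_lattice R = {x. \<forall>i. R * x $ i \<in> \<int>}"

end

theory Submission
  imports Defs
begin

text \<open>
  Near a point of \<open>S\<close> where the defining function has nonzero derivative along a coordinate axis \<open>e\<close>,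
  the intermediate value theorem yields a point of \<open>S\<close> on each line parallel to \<open>e\<close>.
  The perturbation is a shear \<open>x \<mapsto> x + \<Psi> x *\<^sub>R e\<close> with \<open>\<Psi>\<close> constant along \<open>e\<close>, so its inverse is
  \<open>x \<mapsto> x - \<Psi> x *\<^sub>R e\<close>. Here \<open>\<Psi>\<close> is a small constant plus a small tilt \<open>\<Sum>i. \<tau> i * sin (x\<^sub>i - p\<^sub>i)\<close> (bounded
  with all its derivatives, so that \<open>S\<close> may be unbounded) plus disjoint bumps of radius \<open>r\<close>.
  A bump of height \<open>O(\<epsilon> r\<^sup>2)\<close> is \<open>O(\<epsilon>)\<close> in the second derivative, so a lattice point at vertical distance
  \<open>O(\<epsilon> r\<^sup>2)\<close> from \<open>S\<close> can be caught. For a random shift and tilt, the expected number of such points in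
  a patch of radius \<open>r\<close> is about \<open>R^n r^(n+1)\<close>, and the tilt makes coincidences
  rare; thus \<open>r\<close> of order \<open>R powr (- n / (n + 1))\<close> gives about \<open>r powr (1 - n)\<close> separated points.
\<close>

section \<open>Separated points with nearly integral values\<close>

lemma card_int_near:
  fixes \<alpha> \<beta> w :: real
  assumes "\<alpha> \<noteq> 0" "0 \<le> w"
  shows "finite {j::int. \<bar>\<alpha> * j - \<beta>\<bar> \<le> w}"
    and "real (card {j::int. \<bar>\<alpha> * j - \<beta>\<bar> \<le> w}) \<le> 2 * w / \<bar>\<alpha>\<bar> + 1"
proof -
  have sub: "{j::int. \<bar>\<alpha> * j - \<beta>\<bar> \<le> w} \<subseteq> {\<lceil>\<beta> / \<alpha> - w / \<bar>\<alpha>\<bar>\<rceil>..\<lfloor>\<beta> / \<alpha> + w / \<bar>\<alpha>\<bar>\<rfloor>}"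
  proof
    fix j :: int assume "j \<in> {j::int. \<bar>\<alpha> * j - \<beta>\<bar> \<le> w}"
    then have "\<bar>\<alpha> * j - \<beta>\<bar> / \<bar>\<alpha>\<bar> \<le> w / \<bar>\<alpha>\<bar>"
      by (intro divide_right_mono) auto
    moreover have "\<bar>\<alpha> * j - \<beta>\<bar> / \<bar>\<alpha>\<bar> = \<bar>j - \<beta> / \<alpha>\<bar>"
      using assms by (simp add: diff_divide_distrib flip: abs_divide)
    ultimately have "\<bar>j - \<beta> / \<alpha>\<bar> \<le> w / \<bar>\<alpha>\<bar>" by simp
    then show "j \<in> {\<lceil>\<beta> / \<alpha> - w / \<bar>\<alpha>\<bar>\<rceil>..\<lfloor>\<beta> / \<alpha> + w / \<bar>\<alpha>\<bar>\<rfloor>}"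
      by (auto simp: ceiling_le_iff le_floor_iff)
  qed
  then show "finite {j::int. \<bar>\<alpha> * j - \<beta>\<bar> \<le> w}"
    using finite_subset by blast
  have "real (card {j::int. \<bar>\<alpha> * j - \<beta>\<bar> \<le> w})
      \<le> real (card {\<lceil>\<beta> / \<alpha> - w / \<bar>\<alpha>\<bar>\<rceil>..\<lfloor>\<beta> / \<alpha> + w / \<bar>\<alpha>\<bar>\<rfloor>})"
    using card_mono[OF _ sub] by simp
  also have "\<dots> \<le> 2 * w / \<bar>\<alpha>\<bar> + 1"
  proof -
    define z where "z = \<lfloor>\<beta> / \<alpha> + w / \<bar>\<alpha>\<bar>\<rfloor> - \<lceil>\<beta> / \<alpha> - w / \<bar>\<alpha>\<bar>\<rceil> + 1"
    have "real_of_int z \<le> 2 * w / \<bar>\<alpha>\<bar> + 1"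
      unfolding z_def by (simp, linarith)
    moreover have "0 \<le> 2 * w / \<bar>\<alpha>\<bar> + 1" using assms by simp
    moreover have "real (nat z) = max 0 (real_of_int z)" by simp
    ultimately show ?thesis by (simp add: z_def)
  qed
  finally show "real (card {j::int. \<bar>\<alpha> * j - \<beta>\<bar> \<le> w}) \<le> 2 * w / \<bar>\<alpha>\<bar> + 1" .
qed

text \<open>The progression sweeps a length of at most \<open>J * \<bar>\<gamma>\<bar>\<close>, so
  it comes close to at most \<open>J * \<bar>\<gamma>\<bar> + 2\<close> integers, and by the
  preceding count each of these is approached by at most
  \<open>2 * w / \<bar>\<gamma>\<bar> + 1\<close> indices.\<close>

lemma card_progression_near_int:
  fixes c \<gamma> w :: real
  assumes "\<gamma> \<noteq> 0" "0 \<le> w" "w \<le> 1/2"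
  shows "real (card {j\<in>{..<J}. \<exists>N::int. \<bar>c + \<gamma> * real j - N\<bar> \<le> w})
    \<le> (real J * \<bar>\<gamma>\<bar> + 2) * (2 * w / \<bar>\<gamma>\<bar> + 1)"
proof -
  \<comment> \<open>The integers in question are counted around the midpoint of the progression; the
    margin 1/2 absorbs \<open>w\<close>.\<close>
  define B where "B = {N::int. \<bar>1 * N - (c + \<gamma> * J / 2)\<bar> \<le> \<bar>\<gamma>\<bar> * J / 2 + 1/2}"
  define C where "C = (\<lambda>N::int. {j::nat. \<bar>\<gamma> * int j - (N - c)\<bar> \<le> w})"
  have B: "finite B" "real (card B) \<le> real J * \<bar>\<gamma>\<bar> + 2"
    unfolding B_def using card_int_near[of 1 "\<bar>\<gamma>\<bar> * J / 2 + 1/2" "c + \<gamma> * J / 2"]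
    by (auto simp: algebra_simps)
  have C: "finite (C N)" "real (card (C N)) \<le> 2 * w / \<bar>\<gamma>\<bar> + 1" for N
  proof -
    have *: "int ` C N \<subseteq> {j::int. \<bar>\<gamma> * j - (N - c)\<bar> \<le> w}" by (auto simp: C_def)
    show "finite (C N)"
      using finite_subset[OF * card_int_near(1)] assms by (simp add: finite_image_iff)
    have "card (C N) = card (int ` C N)" by (simp add: card_image)
    also have "\<dots> \<le> card {j::int. \<bar>\<gamma> * j - (N - c)\<bar> \<le> w}"
      using * card_int_near(1) assms by (intro card_mono) auto
    finally show "real (card (C N)) \<le> 2 * w / \<bar>\<gamma>\<bar> + 1"
      using card_int_near(2)[of \<gamma> w "N - c"] assms by linarith
  qed
  have sub: "{j\<in>{..<J}. \<exists>N::int. \<bar>c + \<gamma> * real j - N\<bar> \<le> w} \<subseteq> (\<Union>N\<in>B. C N)"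
  proof
    fix j assume "j \<in> {j\<in>{..<J}. \<exists>N::int. \<bar>c + \<gamma> * real j - N\<bar> \<le> w}"
    then obtain N :: int where N: "j < J" "\<bar>c + \<gamma> * real j - N\<bar> \<le> w" by auto
    have "real j < real J" using N by simp
    then have "\<bar>real j - real J / 2\<bar> \<le> real J / 2" by linarith
    then have "\<bar>\<gamma> * (real j - J / 2)\<bar> \<le> \<bar>\<gamma>\<bar> * (J / 2)"
      unfolding abs_mult by (intro mult_left_mono) auto
    moreover have "\<gamma> * (real j - J / 2) = \<gamma> * real j - \<gamma> * J / 2" by (simp add: right_diff_distrib)
    moreover have "\<bar>N - (c + v)\<bar> \<le> h + 1/2"
      if "\<bar>g\<bar> \<le> h" "g = u - v" "\<bar>c + u - N\<bar> \<le> w" for g h u v :: real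
      using that assms(3) by linarith
    ultimately have "\<bar>1 * N - (c + \<gamma> * J / 2)\<bar> \<le> \<bar>\<gamma>\<bar> * J / 2 + 1/2"
      using N(2) by fastforce
    then have "N \<in> B" by (simp add: B_def)
    moreover have "j \<in> C N" using N by (auto simp: C_def algebra_simps abs_minus_commute)
    ultimately show "j \<in> (\<Union>N\<in>B. C N)" by blast
  qed
  have "real (card {j\<in>{..<J}. \<exists>N::int. \<bar>c + \<gamma> * real j - N\<bar> \<le> w}) \<le> real (card (\<Union>N\<in>B. C N))"
    using B C sub by (intro of_nat_mono card_mono) auto
  also have "\<dots> \<le> (\<Sum>N\<in>B. real (card (C N)))"
    using card_UN_le[OF B(1), of C] of_nat_mono by fastforce
  also have "\<dots> \<le> real (card B) * (2 * w / \<bar>\<gamma>\<bar> + 1)"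
    using sum_bounded_above[of B "\<lambda>N. real (card (C N))"] C by simp
  also have "\<dots> \<le> (real J * \<bar>\<gamma>\<bar> + 2) * (2 * w / \<bar>\<gamma>\<bar> + 1)"
    using B assms by (intro mult_right_mono) auto
  finally show ?thesis .
qed

text \<open>Fubini for counting: functions are grouped by their values on \<open>I - {i}\<close>,
  encoded by resetting coordinate \<open>i\<close> to \<open>undefined\<close>, and every fibre
  obeys the bound \<open>M\<close>.\<close>

lemma card_PiE_slice_le:
  assumes "finite I" "i \<in> I"
    and "\<And>f. real (card {x\<in>{..<J::nat}. P (f(i := x))}) \<le> M"
  shows "real (card {f \<in> I \<rightarrow>\<^sub>E {..<J}. P f}) \<le> real J ^ (card I - 1) * M"
proof -
  let ?I = "I - {i}"
  have fin: "finite (?I \<rightarrow>\<^sub>E {..<J})" using assms by (intro finite_PiE) auto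
  have sub: "{f \<in> I \<rightarrow>\<^sub>E {..<J}. P f}
    \<subseteq> (\<Union>f\<in>?I \<rightarrow>\<^sub>E {..<J}. (\<lambda>x. f(i := x)) ` {x\<in>{..<J}. P (f(i := x))})"
  proof
    fix f assume f: "f \<in> {f \<in> I \<rightarrow>\<^sub>E {..<J}. P f}"
    have "f(i := undefined) \<in> ?I \<rightarrow>\<^sub>E {..<J}" using f by (auto simp: PiE_def extensional_def Pi_def)
    moreover have "f = (\<lambda>x. (f(i := undefined))(i := x)) (f i)" by auto
    ultimately show "f \<in> (\<Union>f\<in>?I \<rightarrow>\<^sub>E {..<J}. (\<lambda>x. f(i := x)) ` {x\<in>{..<J}. P (f(i := x))})"
      using f assms(2) by (intro UN_I[of "f(i := undefined)"] image_eqI[of _ _ "f i"]) auto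
  qed
  have "real (card {f \<in> I \<rightarrow>\<^sub>E {..<J}. P f})
    \<le> real (card (\<Union>f\<in>?I \<rightarrow>\<^sub>E {..<J}. (\<lambda>x. f(i := x)) ` {x\<in>{..<J}. P (f(i := x))}))"
    using fin sub by (intro of_nat_mono card_mono) auto
  also have "\<dots> \<le> (\<Sum>f\<in>?I \<rightarrow>\<^sub>E {..<J}. real (card ((\<lambda>x. f(i := x)) ` {x\<in>{..<J}. P (f(i := x))})))"
    using card_UN_le[OF fin, of "\<lambda>f. (\<lambda>x. f(i := x)) ` {x\<in>{..<J}. P (f(i := x))}"] of_nat_mono
    by fastforce
  also have "\<dots> \<le> (\<Sum>f\<in>?I \<rightarrow>\<^sub>E {..<J}. M)"
  proof (rule sum_mono)
    fix f :: "'a \<Rightarrow> nat"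
    have "real (card ((\<lambda>x. f(i := x)) ` {x\<in>{..<J}. P (f(i := x))})) \<le> real (card {x\<in>{..<J}. P (f(i := x))})"
      by (intro of_nat_mono card_image_le) auto
    then show "real (card ((\<lambda>x. f(i := x)) ` {x\<in>{..<J}. P (f(i := x))})) \<le> M"
      using assms(3)[of f] by linarith
  qed
  also have "\<dots> = real J ^ (card I - 1) * M"
    using assms by (simp add: card_PiE)
  finally show ?thesis .
qed

text \<open>Only coordinate \<open>i\<close> varies; the other tilts go into the constant. The
  values then form a progression of step \<open>s * \<alpha> i\<close>. Since this step is at most
  \<open>2 * w\<close> in size, the summand 1 of the progression bound is absorbed; since the range
  \<open>J * s\<close> is at least \<open>\<epsilon> / 2\<close>, the summand 2 costs a factor of
  order \<open>1 / \<epsilon>\<close>. The two contributions give 36 = 4 + 32.\<close>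

lemma card_tilts_near_int:
  fixes c s w \<epsilon> :: real and \<alpha> :: "'i \<Rightarrow> real"
  assumes "finite I" "i \<in> I" and \<alpha>: "1/2 \<le> \<bar>\<alpha> i\<bar>" "\<bar>\<alpha> i\<bar> * s \<le> 2 * w"
    and s: "0 < s" and w: "0 \<le> w" "w \<le> 1/2" and \<epsilon>: "0 < \<epsilon>" "\<epsilon> \<le> 1" "\<epsilon> / 2 \<le> real J * s"
  shows "real (card {j \<in> I \<rightarrow>\<^sub>E {..<J}. \<exists>N::int. \<bar>c + (\<Sum>i\<in>I. real (j i) * s * \<alpha> i) - N\<bar> \<le> w})
    \<le> real J ^ card I * (36 * w / \<epsilon>)"
proof -
  have slice: "real (card {x\<in>{..<J}. \<exists>N::int. \<bar>c + (\<Sum>l\<in>I. real ((f(i := x)) l) * s * \<alpha> l) - N\<bar> \<le> w})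
     \<le> real J * (36 * w / \<epsilon>)" for f :: "'i \<Rightarrow> nat"
  proof -
    define \<gamma> where "\<gamma> = s * \<alpha> i"
    have \<gamma>: "\<gamma> \<noteq> 0" "\<bar>\<gamma>\<bar> = s * \<bar>\<alpha> i\<bar>" "\<bar>\<gamma>\<bar> \<le> 2 * w" "s / 2 \<le> \<bar>\<gamma>\<bar>"
      using \<alpha> s by (auto simp: \<gamma>_def abs_mult mult.commute)
    have "(\<Sum>l\<in>I. real ((f(i := x)) l) * s * \<alpha> l) = (\<Sum>l\<in>I-{i}. real (f l) * s * \<alpha> l) + \<gamma> * real x" for x
      using assms(1,2) by (simp add: sum.remove \<gamma>_def)
    then have "real (card {x\<in>{..<J}. \<exists>N::int. \<bar>c + (\<Sum>l\<in>I. real ((f(i := x)) l) * s * \<alpha> l) - N\<bar> \<le> w})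
       \<le> (real J * \<bar>\<gamma>\<bar> + 2) * (2 * w / \<bar>\<gamma>\<bar> + 1)"
      using card_progression_near_int[OF \<gamma>(1) w, of J "c + (\<Sum>l\<in>I-{i}. real (f l) * s * \<alpha> l)"]
      by (simp add: add.assoc)
    also have "\<dots> \<le> (real J * \<bar>\<gamma>\<bar> + 2) * (4 * w / \<bar>\<gamma>\<bar>)"
    proof (rule mult_left_mono)
      have "1 \<le> 2 * w / \<bar>\<gamma>\<bar>" using \<gamma>(1,3) by (simp add: le_divide_eq)
      moreover have "4 * w / \<bar>\<gamma>\<bar> = 2 * w / \<bar>\<gamma>\<bar> + 2 * w / \<bar>\<gamma>\<bar>" by simp
      ultimately show "2 * w / \<bar>\<gamma>\<bar> + 1 \<le> 4 * w / \<bar>\<gamma>\<bar>" by linarith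
    qed simp
    also have "\<dots> = 4 * w * real J + 8 * w / \<bar>\<gamma>\<bar>"
      using \<gamma>(1) by (simp add: field_simps)
    also have "\<dots> \<le> 4 * w * real J + 8 * w / (s / 2)"
      using \<gamma> s w by (intro add_left_mono divide_left_mono) auto
    also have "\<dots> \<le> 4 * w * real J / \<epsilon> + 32 * w * real J / \<epsilon>"
    proof (rule add_mono)
      show "4 * w * real J \<le> 4 * w * real J / \<epsilon>"
        using \<epsilon> w by (simp add: le_divide_eq mult_left_le)
      have "16 * w * \<epsilon> \<le> 16 * w * (2 * (real J * s))" using \<epsilon> w by (intro mult_left_mono) auto
      then show "8 * w / (s / 2) \<le> 32 * w * real J / \<epsilon>"
        using \<epsilon> s by (simp add: field_simps)
    qed
    also have "\<dots> = real J * (36 * w / \<epsilon>)" by (simp add: field_simps)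
    finally show ?thesis .
  qed
  have "0 < card I" using assms(1,2) by (auto simp: card_gt_0_iff)
  then have "card I = Suc (card I - 1)" by simp
  then have "real J ^ card I = real J ^ (card I - 1) * real J" by (metis power_Suc2)
  then show ?thesis
    using card_PiE_slice_le[OF assms(1,2), where P = "\<lambda>j. \<exists>N::int. \<bar>c + (\<Sum>i\<in>I. real (j i) * s * \<alpha> i) - N\<bar> \<le> w", OF slice]
    by (simp add: mult.assoc)
qed

section \<open>Averaging over tilts and shifts\<close>

text \<open>
  Averaging over a finite grid of tilts \<open>\<tau>\<close> and shifts \<open>t\<close>: each \<open>a\<close> is hit by exactly one shift per tilt, and
  a pair of close points is rarely hit by the same parameters, since its difference is moved by the
  tilt. So for some parameters the hits outnumber the close pairs of hits, and deleting
  one point of each close pair leaves a separated set.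
\<close>
lemma exists_separated_points_near_int:
  fixes \<theta> :: "'i \<Rightarrow> int \<Rightarrow> real" and F :: "('i \<Rightarrow> int) \<Rightarrow> real" and \<epsilon> :: real and L q :: nat
  assumes I: "finite I" and A: "finite A" "A \<subseteq> extensional I"
    and \<theta>: "\<And>a b i. \<lbrakk>a \<in> A; b \<in> A; i \<in> I; \<bar>a i - b i\<bar> \<le> int L; a i \<noteq> b i\<rbrakk>
      \<Longrightarrow> 1/2 \<le> \<bar>\<theta> i (a i) - \<theta> i (b i)\<bar> \<and> \<bar>\<theta> i (a i) - \<theta> i (b i)\<bar> \<le> real L"
    and \<epsilon>: "0 < \<epsilon>" "\<epsilon> \<le> 1" and L: "1 \<le> L"
    and q: "72 * (2 * real L + 1) ^ card I \<le> real q * \<epsilon>"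
  obtains X \<tau> t where "X \<subseteq> A" "\<And>i. 0 \<le> \<tau> i \<and> \<tau> i \<le> \<epsilon>" "0 \<le> t" "t \<le> 1"
    "\<And>a. a \<in> X \<Longrightarrow> \<exists>N::int. \<bar>F a + t + (\<Sum>i\<in>I. \<tau> i * \<theta> i (a i)) - N\<bar> \<le> 1 / real q"
    "\<And>a b. \<lbrakk>a \<in> X; b \<in> X; a \<noteq> b\<rbrakk> \<Longrightarrow> \<exists>i\<in>I. \<bar>a i - b i\<bar> > int L"
    "real (card A) \<le> 2 * real q * real (card X)"
proof -
  have q72: "72 \<le> real q * \<epsilon>"
    using q one_le_power[of "2 * real L + 1" "card I"] by linarith
  have qge: "72 \<le> real q"
    using q72 \<epsilon> by (smt (verit) mult_left_le of_nat_0_le_iff)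
  \<comment> \<open>The tilts are the multiples of \<open>s\<close> in
    \<open>[0, \<epsilon>]\<close>. With this step, one increment of a tilt moves the difference of
    two close points by at most \<open>real L * s = 1 / real q\<close>, the width of the
    target.\<close>
  define s where "s = 1 / (real q * real L)"
  define J where "J = nat \<lfloor>\<epsilon> / s\<rfloor>"
  have s: "0 < s" using qge L by (simp add: s_def)
  have eps_s: "\<epsilon> / s = real q * \<epsilon> * real L" by (simp add: s_def)
  have "real q * \<epsilon> * 1 \<le> real q * \<epsilon> * real L" using L q72 by (intro mult_left_mono) auto
  then have es72: "72 \<le> \<epsilon> / s" using q72 eps_s by linarith
  have J: "real J \<le> \<epsilon> / s" "\<epsilon> / s - 1 \<le> real J" using es72 by (auto simp: J_def)
  have Js: "real J * s \<le> \<epsilon>" "\<epsilon> / 2 \<le> real J * s"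
  proof -
    show "real J * s \<le> \<epsilon>" using J(1) s by (simp add: field_simps)
    have "e / 2 \<le> real J" if "72 \<le> e" "e - 1 \<le> real J" for e using that by linarith
    from this[OF es72 J(2)] have "\<epsilon> / s / 2 \<le> real J" .
    then show "\<epsilon> / 2 \<le> real J * s" using s by (simp add: field_simps)
  qed
  have Jpos: "J > 0" using J es72 by (auto intro: gr0I)
  define w where "w = 1 / real q"
  have w: "0 \<le> w" "w \<le> 1/2" using qge by (auto simp: w_def field_simps)
  define G where "G = I \<rightarrow>\<^sub>E {..<J}"
  have finG: "finite G" and cardG: "card G = J ^ card I"
    using I by (auto simp: G_def card_PiE intro: finite_PiE)
  define v where "v = (\<lambda>j a. F a + (\<Sum>i\<in>I. real (j i) * s * \<theta> i (a i)))"
  \<comment> \<open>The value with shift \<open>k / q\<close> lies in a half-open interval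
    \<open>[N, N + 1/q)\<close> for an integer \<open>N\<close>. Because the target is one-sided and
    has exactly the width of one shift step, precisely one \<open>k\<close> per tilt
    succeeds.\<close>
  define hit where "hit = (\<lambda>(j, k) a. (\<lfloor>real q * v j a\<rfloor> + int k) mod int q = 0)"
  define X where "X = (\<lambda>\<omega>. {a\<in>A. hit \<omega> a})"
  define close where "close = {(a, b). a \<in> A \<and> b \<in> A \<and> a \<noteq> b \<and> (\<forall>i\<in>I. \<bar>a i - b i\<bar> \<le> int L)}"
  define D where "D = (\<lambda>\<omega>. {p\<in>close. hit \<omega> (fst p) \<and> hit \<omega> (snd p)})"
  let ?\<Omega> = "G \<times> {..<q}"
  have fin\<Omega>: "finite ?\<Omega>" using finG by simp
  have finclose: "finite close"
    by (rule finite_subset[of _ "A \<times> A"]) (auto simp: close_def A)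
  have hitD: "\<exists>N::int. \<exists>f. 0 \<le> f \<and> f < 1 \<and> v j a + real k / q = N + f / q" if "hit (j, k) a" for j k a
  proof -
    from that obtain N where N: "\<lfloor>real q * v j a\<rfloor> + int k = int q * N"
      unfolding hit_def by (auto simp: mod_eq_0_iff_dvd)
    define f where "f = frac (real q * v j a)"
    have "real q * v j a = \<lfloor>real q * v j a\<rfloor> + f" by (simp add: f_def frac_def)
    also have "\<dots> = real_of_int (int q * N - int k) + f" using N by (metis add_diff_cancel_right')
    finally have "v j a + real k / q = N + f / q" using qge by (simp add: field_simps)
    then show ?thesis unfolding f_def using frac_ge_0 frac_lt_1 by blast
  qed
  have one_k: "card {k\<in>{..<q}. hit (j, k) a} = 1" for j a
  proof -
    define k0 where "k0 = nat ((- \<lfloor>real q * v j a\<rfloor>) mod int q)"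
    have q0: "0 < int q" using qge by simp
    have k0: "int k0 = (- \<lfloor>real q * v j a\<rfloor>) mod int q" "k0 < q"
      using q0 by (auto simp: k0_def nat_less_iff)
    have "hit (j, k) a \<longleftrightarrow> k = k0" if "k < q" for k
    proof -
      have "hit (j, k) a \<longleftrightarrow> int k mod int q = (- \<lfloor>real q * v j a\<rfloor>) mod int q"
        unfolding hit_def by (simp add: mod_eq_dvd_iff add.commute mod_eq_0_iff_dvd)
      also have "\<dots> \<longleftrightarrow> k = k0" using that k0(1) by (metis int_eq_iff_numeral mod_pos_pos_trivial of_nat_0_le_iff of_nat_eq_iff of_nat_less_iff)
      finally show ?thesis .
    qed
    then have "{k\<in>{..<q}. hit (j, k) a} = {k0}" using k0(2) by auto
    then show ?thesis by simp
  qed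
  have swap: "(\<Sum>\<omega>\<in>?\<Omega>. card {p\<in>B. Q \<omega> p}) = (\<Sum>p\<in>B. \<Sum>j\<in>G. card {k\<in>{..<q}. Q (j, k) p})"
    if "finite B" for B :: "'z set" and Q
  proof -
    have "(\<Sum>\<omega>\<in>?\<Omega>. card {p\<in>B. Q \<omega> p}) = (\<Sum>\<omega>\<in>?\<Omega>. \<Sum>p\<in>B. if Q \<omega> p then 1 else 0)"
      using that by (simp add: sum.If_cases Int_def)
    also have "\<dots> = (\<Sum>p\<in>B. \<Sum>\<omega>\<in>?\<Omega>. if Q \<omega> p then 1 else 0)" by (rule sum.swap)
    also have "\<dots> = (\<Sum>p\<in>B. \<Sum>j\<in>G. \<Sum>k<q. if Q (j, k) p then 1 else 0)"
      by (simp add: sum.cartesian_product)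
    also have "\<dots> = (\<Sum>p\<in>B. \<Sum>j\<in>G. card {k\<in>{..<q}. Q (j, k) p})"
      by (simp add: sum.If_cases Int_def)
    finally show ?thesis .
  qed
  have sumX: "(\<Sum>\<omega>\<in>?\<Omega>. card (X \<omega>)) = card A * J ^ card I"
    unfolding X_def swap[OF A(1)] one_k by (simp add: cardG)
  have pair: "(\<Sum>j\<in>G. card {k\<in>{..<q}. hit (j, k) (fst p) \<and> hit (j, k) (snd p)})
      \<le> real J ^ card I * (36 * w / \<epsilon>)" if p: "p \<in> close" for p
  proof -
    obtain a b where ab: "p = (a, b)" by fastforce
    have ab': "a \<in> A" "b \<in> A" "a \<noteq> b" and le: "\<And>i. i \<in> I \<Longrightarrow> \<bar>a i - b i\<bar> \<le> int L"
      using p by (auto simp: ab close_def)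
    define \<alpha> where "\<alpha> = (\<lambda>i. \<theta> i (a i) - \<theta> i (b i))"
    define T where "T = {j\<in>G. \<exists>N::int. \<bar>(F a - F b) + (\<Sum>i\<in>I. real (j i) * s * \<alpha> i) - N\<bar> \<le> w}"
    obtain i where i: "i \<in> I" "a i \<noteq> b i"
      using ab' A(2) by (meson extensionalityI subsetD)
    have \<alpha>: "1/2 \<le> \<bar>\<alpha> i\<bar>" "\<bar>\<alpha> i\<bar> \<le> real L"
      using \<theta>[OF ab'(1,2) i(1) le[OF i(1)] i(2)] by (auto simp: \<alpha>_def)
    have "\<bar>\<alpha> i\<bar> * s \<le> real L * s" using \<alpha> s by (intro mult_right_mono) auto
    also have "\<dots> = w" using L by (simp add: s_def w_def)
    finally have \<alpha>s: "\<bar>\<alpha> i\<bar> * s \<le> 2 * w" using w by linarith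
    \<comment> \<open>Two hits under the same parameters share the shift, which cancels in the
      difference; what remains depends on the tilt alone.\<close>
    have inT: "j \<in> T" if jG: "j \<in> G" and hits: "hit (j, k) a" "hit (j, k) b" for j k
    proof -
      obtain N f M g where h: "0 \<le> f" "f < 1" "v j a + real k / q = of_int N + f / q"
         "0 \<le> g" "g < 1" "v j b + real k / q = of_int M + g / q"
        using hitD[OF hits(1)] hitD[OF hits(2)] by blast
      have "v j a - v j b - of_int (N - M) = (f - g) / q"
        using h(3,6) by (simp add: diff_divide_distrib)
      moreover have "\<bar>(f - g) / q\<bar> \<le> w" using h qge by (auto simp: w_def abs_divide intro!: divide_right_mono)
      moreover have "v j a - v j b = (F a - F b) + (\<Sum>i\<in>I. real (j i) * s * \<alpha> i)"
        by (simp add: v_def \<alpha>_def right_diff_distrib sum_subtractf)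
      ultimately have "\<bar>(F a - F b) + (\<Sum>i\<in>I. real (j i) * s * \<alpha> i) - of_int (N - M)\<bar> \<le> w" by metis
      then show ?thesis using jG unfolding T_def by blast
    qed
    have "(\<Sum>j\<in>G. card {k\<in>{..<q}. hit (j, k) (fst p) \<and> hit (j, k) (snd p)})
        \<le> (\<Sum>j\<in>G. if j \<in> T then 1 else 0)"
    proof (rule sum_mono)
      fix j assume j: "j \<in> G"
      have "card {k\<in>{..<q}. hit (j, k) (fst p) \<and> hit (j, k) (snd p)} \<le> card {k\<in>{..<q}. hit (j, k) a}"
        by (rule card_mono) (auto simp: ab)
      then have "card {k\<in>{..<q}. hit (j, k) (fst p) \<and> hit (j, k) (snd p)} \<le> 1" unfolding one_k .
      then show "card {k\<in>{..<q}. hit (j, k) (fst p) \<and> hit (j, k) (snd p)} \<le> (if j \<in> T then 1 else 0)"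
        using inT[OF j] by (auto simp: ab)
    qed
    also have "\<dots> = card T"
    proof -
      have "T \<subseteq> G" by (auto simp: T_def)
      then have "G \<inter> T = T" by blast
      then show ?thesis using finG by (simp add: sum.If_cases)
    qed
    finally have "real (\<Sum>j\<in>G. card {k\<in>{..<q}. hit (j, k) (fst p) \<and> hit (j, k) (snd p)}) \<le> real (card T)"
      by (rule of_nat_mono)
    also have "\<dots> \<le> real J ^ card I * (36 * w / \<epsilon>)"
      unfolding T_def G_def
      by (rule card_tilts_near_int[where \<alpha> = \<alpha>, OF I i(1) \<alpha>(1) \<alpha>s s w \<epsilon> Js(2)])
    finally show ?thesis .
  qed
  \<comment> \<open>Elements of \<open>A\<close> are extensional, so everything close to
    \<open>a\<close> lies in a box with \<open>(2 * L + 1) ^ card I\<close> elements.\<close>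
  have cardclose: "real (card close) \<le> real (card A) * (2 * real L + 1) ^ card I"
  proof -
    define nb where "nb = (\<lambda>a. PiE I (\<lambda>i. {a i - int L..a i + int L}))"
    have sub: "close \<subseteq> Sigma A nb"
    proof
      fix p assume p: "p \<in> close"
      obtain a b where ab: "p = (a, b)" by fastforce
      have "b i \<in> {a i - int L..a i + int L}" if "i \<in> I" for i
      proof -
        have "\<bar>a i - b i\<bar> \<le> int L" using p that by (auto simp: ab close_def)
        then show ?thesis by auto
      qed
      then show "p \<in> Sigma A nb" using p A(2) by (auto simp: ab close_def nb_def PiE_def)
    qed
    have fin: "finite (nb a)" for a using I by (auto simp: nb_def intro!: finite_PiE)
    have card: "card (nb a) = (2 * L + 1) ^ card I" for a
      using I by (simp add: nb_def card_PiE nat_add_distrib nat_mult_distrib)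
    have "card close \<le> card (Sigma A nb)"
      using A(1) fin sub by (intro card_mono finite_SigmaI) auto
    also have "\<dots> = card A * (2 * L + 1) ^ card I"
      by (subst card_SigmaI) (simp_all add: A(1) fin card del: power_Suc)
    finally have "card close \<le> card A * (2 * L + 1) ^ card I" .
    then have "real (card close) \<le> real (card A * (2 * L + 1) ^ card I)" using of_nat_mono by blast
    then show ?thesis by (simp add: add.commute)
  qed
  \<comment> \<open>The 72 in the hypothesis on \<open>q\<close> is twice the 36 of the tilt count:
    the total of close pairs of hits comes out as at most half the total of hits.\<close>
  have "real (\<Sum>\<omega>\<in>?\<Omega>. card (D \<omega>)) = (\<Sum>p\<in>close. real (\<Sum>j\<in>G. card {k\<in>{..<q}. hit (j, k) (fst p) \<and> hit (j, k) (snd p)}))"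
    unfolding D_def swap[OF finclose] by (rule of_nat_sum)
  also have "\<dots> \<le> real (card close) * (real J ^ card I * (36 * w / \<epsilon>))"
    by (rule order.trans[OF sum_mono[where g = "\<lambda>_. real J ^ card I * (36 * w / \<epsilon>)"]])
      (use pair in \<open>auto simp only: sum_constant\<close>)
  also have "\<dots> \<le> real (card A) * (2 * real L + 1) ^ card I * (real J ^ card I * (36 * w / \<epsilon>))"
    using cardclose w \<epsilon> by (intro mult_right_mono) auto
  also have "\<dots> = real (card A) * real J ^ card I * ((72 * (2 * real L + 1) ^ card I) * (w / \<epsilon>)) / 2"
    by simp
  also have "\<dots> \<le> real (card A) * real J ^ card I * ((real q * \<epsilon>) * (w / \<epsilon>)) / 2"
    using q w \<epsilon> by (intro divide_right_mono mult_left_mono mult_right_mono) auto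
  also have "\<dots> = real (card A) * real J ^ card I / 2"
    using \<epsilon> qge by (simp add: w_def)
  finally have sumD: "real (\<Sum>\<omega>\<in>?\<Omega>. card (D \<omega>)) \<le> real (card A) * real J ^ card I / 2" .
  \<comment> \<open>Some parameter does at least as well as the average over the
    \<open>q * J ^ card I\<close> parameters.\<close>
  obtain \<omega> where \<omega>: "\<omega> \<in> ?\<Omega>" "real (card A) / (2 * q) \<le> real (card (X \<omega>)) - real (card (D \<omega>))"
  proof -
    have "\<exists>\<omega>\<in>?\<Omega>. real (card A) / (2 * q) \<le> real (card (X \<omega>)) - real (card (D \<omega>))"
    proof (rule ccontr)
      assume "\<not> ?thesis"
      then have less: "real (card (X \<omega>)) - real (card (D \<omega>)) < real (card A) / (2 * q)" if "\<omega> \<in> ?\<Omega>" for \<omega>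
        using that by (meson not_less)
      have "G \<noteq> {}" "0 \<in> {..<q}" using Jpos qge by (auto simp: G_def PiE_eq_empty_iff)
      then have "?\<Omega> \<noteq> {}" by blast
      then have "(\<Sum>\<omega>\<in>?\<Omega>. real (card (X \<omega>)) - real (card (D \<omega>))) < (\<Sum>\<omega>\<in>?\<Omega>. real (card A) / (2 * q))"
        using fin\<Omega> less by (intro sum_strict_mono)
      also have "\<dots> = real (card A) * real J ^ card I / 2"
        using qge by (simp add: card_cartesian_product cardG)
      finally have "real (\<Sum>\<omega>\<in>?\<Omega>. card (X \<omega>)) - real (\<Sum>\<omega>\<in>?\<Omega>. card (D \<omega>)) < real (card A) * real J ^ card I / 2"
        by (simp add: sum_subtractf)
      then show False using sumD unfolding sumX by simp
    qed
    then show ?thesis using that by blast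
  qed
  obtain j k where jk: "\<omega> = (j, k)" "j \<in> G" "k < q" using \<omega> by auto
  \<comment> \<open>\<open>close\<close> is symmetric, so both members of each close pair of hits
    disappear; still at most \<open>card (D \<omega>)\<close> points are removed.\<close>
  define Y where "Y = X \<omega> - fst ` D \<omega>"
  have finX: "finite (X \<omega>)" and finD: "finite (D \<omega>)" using A finclose by (auto simp: X_def D_def)
  \<comment> \<open>The default 0 outside \<open>I\<close> keeps the bounds on \<open>\<tau>\<close>
    valid for every index.\<close>
  define \<tau> where "\<tau> = (\<lambda>i. if i \<in> I then real (j i) * s else 0)"
  show thesis
  proof (rule that[of Y \<tau> "real k / q"])
    show "Y \<subseteq> A" by (auto simp: Y_def X_def)
    show "0 \<le> \<tau> i \<and> \<tau> i \<le> \<epsilon>" for i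
    proof (cases "i \<in> I")
      case True
      then have "j i < J" using jk by (auto simp: G_def)
      then have "real (j i) * s \<le> real J * s" using s by (intro mult_right_mono) auto
      then have "real (j i) * s \<le> \<epsilon>" using Js(1) by linarith
      then show ?thesis using True s by (auto simp: \<tau>_def)
    qed (use \<epsilon> in \<open>auto simp: \<tau>_def\<close>)
    show "0 \<le> real k / q" "real k / q \<le> 1" using jk by auto
    show "\<exists>N::int. \<bar>F a + real k / q + (\<Sum>i\<in>I. \<tau> i * \<theta> i (a i)) - N\<bar> \<le> 1 / real q" if "a \<in> Y" for a
    proof -
      have "hit (j, k) a" using that jk by (auto simp: Y_def X_def)
      then obtain N f where "0 \<le> f" "f < 1" "v j a + real k / q = of_int N + f / q"
        using hitD by blast
      moreover have "F a + real k / q + (\<Sum>i\<in>I. \<tau> i * \<theta> i (a i)) = v j a + real k / q"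
        by (simp add: v_def \<tau>_def)
      ultimately show ?thesis by (intro exI[of _ N]) (auto intro!: divide_right_mono)
    qed
    show "\<exists>i\<in>I. \<bar>a i - b i\<bar> > int L" if "a \<in> Y" "b \<in> Y" "a \<noteq> b" for a b
    proof (rule ccontr)
      assume "\<not> ?thesis"
      then have "(a, b) \<in> D \<omega>" using that by (auto simp: D_def close_def Y_def X_def not_less)
      then have "a \<in> fst ` D \<omega>" by force
      then show False using that by (simp add: Y_def)
    qed
    have "card (X \<omega>) \<le> card Y + card (fst ` D \<omega>)"
      using diff_card_le_card_Diff[of "fst ` D \<omega>" "X \<omega>"] finD by (simp add: Y_def)
    then have "real (card (X \<omega>)) - real (card (D \<omega>)) \<le> real (card Y)"
      using card_image_le[OF finD, of fst] by linarith
    then have "real (card A) / (2 * q) \<le> real (card Y)" using \<omega> by linarith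
    then show "real (card A) \<le> 2 * real q * real (card Y)" using qge by (simp add: field_simps)
  qed
qed

section \<open>Hypersurfaces and shears of class C2\<close>

lemma is_C2_on_continuous:
  assumes "is_C2_on U f f' f''"
  shows "continuous_on U f" "continuous_on U f'" "continuous_on U f''"
  using assms unfolding is_C2_on_def
  by (blast intro: continuous_at_imp_continuous_on has_derivative_continuous)+

lemma is_C2_on_compose:
  fixes h :: "'a::euclidean_space \<Rightarrow> 'a" and \<phi> :: "'a \<Rightarrow> 'b::real_normed_vector"
  assumes \<phi>: "is_C2_on U \<phi> \<phi>' \<phi>''" and h: "is_C2_on UNIV h h' h''"
  shows "is_C2_on (h -` U) (\<phi> \<circ> h) (\<lambda>x. \<phi>' (h x) o\<^sub>L h' x)
    (\<lambda>x. Blinfun (\<lambda>v. (\<phi>' (h x) o\<^sub>L h'' x v) + (\<phi>'' (h x) (h' x v) o\<^sub>L h' x)))"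
proof -
  have dh: "(h has_derivative blinfun_apply (h' x)) (at x)"
    and dh': "(h' has_derivative blinfun_apply (h'' x)) (at x)" for x
    using h by (auto simp: is_C2_on_def)
  have d2: "((\<lambda>x. \<phi>' (h x) o\<^sub>L h' x) has_derivative
     (\<lambda>v. (\<phi>' (h x) o\<^sub>L h'' x v) + (\<phi>'' (h x) (h' x v) o\<^sub>L h' x))) (at x)" if "h x \<in> U" for x
  proof -
    have "(\<phi>' has_derivative blinfun_apply (\<phi>'' (h x))) (at (h x))"
      using \<phi> that by (auto simp: is_C2_on_def)
    then have "((\<phi>' \<circ> h) has_derivative (blinfun_apply (\<phi>'' (h x)) \<circ> blinfun_apply (h' x))) (at x)"
      by (rule diff_chain_at[OF dh])
    from bounded_bilinear.FDERIV[OF bounded_bilinear_blinfun_compose this dh', unfolded o_def]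
    show ?thesis .
  qed
  have ch: "continuous_on UNIV h" "continuous_on UNIV h'" "continuous_on UNIV h''"
    using is_C2_on_continuous[OF h] by auto
  have c\<phi>: "continuous_on (h -` U) (\<lambda>x. \<phi>' (h x))" "continuous_on (h -` U) (\<lambda>x. \<phi>'' (h x))"
    by (rule continuous_on_compose2[OF is_C2_on_continuous(2)[OF \<phi>]]
        continuous_on_compose2[OF is_C2_on_continuous(3)[OF \<phi>]],
        rule continuous_on_subset[OF ch(1)], auto)+
  have "continuous_on (h -` U)
    (\<lambda>x. Blinfun (\<lambda>v. (\<phi>' (h x) o\<^sub>L h'' x v) + (\<phi>'' (h x) (h' x v) o\<^sub>L h' x)))"
  \<comment> \<open>The space is finite-dimensional, so continuity in operator norm can be tested on
    basis vectors, where \<open>Blinfun\<close> can be unfolded.\<close>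
  proof (rule continuous_on_blinfun_componentwise)
    fix i :: 'a
    have "continuous_on (h -` U) (\<lambda>x. (\<phi>' (h x) o\<^sub>L h'' x i) + (\<phi>'' (h x) (h' x i) o\<^sub>L h' x))"
      by (intro continuous_intros bounded_bilinear.continuous_on[OF bounded_bilinear_blinfun_compose]
          c\<phi> continuous_on_subset[OF ch(2)] continuous_on_subset[OF ch(3)]) auto
    moreover have "bounded_linear (\<lambda>v. (\<phi>' (h x) o\<^sub>L h'' x v) + (\<phi>'' (h x) (h' x v) o\<^sub>L h' x))"
      if "x \<in> h -` U" for x
      using d2 that has_derivative_bounded_linear by blast
    ultimately show "continuous_on (h -` U)
      (\<lambda>x. blinfun_apply (Blinfun (\<lambda>v. (\<phi>' (h x) o\<^sub>L h'' x v) + (\<phi>'' (h x) (h' x v) o\<^sub>L h' x))) i)"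
      by (subst continuous_on_cong[OF refl]) (auto simp: bounded_linear_Blinfun_apply)
  qed
  moreover have "((\<phi> \<circ> h) has_derivative blinfun_apply (\<phi>' (h x) o\<^sub>L h' x)) (at x)" if "h x \<in> U" for x
  proof -
    have "(\<phi> has_derivative blinfun_apply (\<phi>' (h x))) (at (h x))"
      using \<phi> that by (auto simp: is_C2_on_def)
    from diff_chain_at[OF dh this] show ?thesis by (simp add: o_def blinfun_compose.rep_eq)
  qed
  moreover have "blinfun_apply (Blinfun (\<lambda>v. (\<phi>' (h x) o\<^sub>L h'' x v) + (\<phi>'' (h x) (h' x v) o\<^sub>L h' x)))
     = (\<lambda>v. (\<phi>' (h x) o\<^sub>L h'' x v) + (\<phi>'' (h x) (h' x v) o\<^sub>L h' x))" if "h x \<in> U" for x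
    using d2[OF that] has_derivative_bounded_linear bounded_linear_Blinfun_apply by blast
  ultimately show ?thesis using d2 by (auto simp: is_C2_on_def)
qed

text \<open>If \<open>\<phi>\<close> defines \<open>S\<close> near \<open>h p\<close>, then
  \<open>\<phi> \<circ> h\<close> defines the image near \<open>p\<close>. Its derivative cannot
  vanish, because differentiating \<open>h \<circ> g = id\<close> shows that the derivative of
  \<open>h\<close> is surjective.\<close>

lemma c2_hypersurface_image:
  fixes g h :: "real^'n \<Rightarrow> real^'n"
  assumes S: "c2_hypersurface S" and g: "is_C2_on UNIV g g' g''" and h: "is_C2_on UNIV h h' h''"
    and hg: "\<And>x. h (g x) = x" "\<And>x. g (h x) = x"
  shows "c2_hypersurface (g ` S)"
  unfolding c2_hypersurface_def
proof
  fix p assume "p \<in> g ` S"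
  then have "h p \<in> S" using hg by auto
  then obtain U \<phi> \<phi>' \<phi>'' where U: "open U" "h p \<in> U" "is_C2_on U \<phi> \<phi>' \<phi>''"
    "\<And>x. x \<in> U \<Longrightarrow> \<phi>' x \<noteq> 0" "S \<inter> U = {x\<in>U. \<phi> x = (0::real)}"
    using bspec[OF S[unfolded c2_hypersurface_def]] by meson
  have dh: "(h has_derivative blinfun_apply (h' x)) (at x)"
    and dg: "(g has_derivative blinfun_apply (g' x)) (at x)" for x
    using g h by (auto simp: is_C2_on_def)
  have inv: "h' x (g' (h x) v) = v" for x v
  proof -
    have "(h \<circ> g has_derivative blinfun_apply (h' x) \<circ> blinfun_apply (g' (h x))) (at (h x))"
      using diff_chain_at[OF dg, of h "h' x" "h x"] dh[of x] hg by simp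
    moreover have "h \<circ> g = (\<lambda>x. x)" using hg by auto
    ultimately have "blinfun_apply (h' x) \<circ> blinfun_apply (g' (h x)) = (\<lambda>v. v)"
      using has_derivative_unique has_derivative_ident by metis
    then show ?thesis by (metis comp_apply)
  qed
  have "open (h -` U)"
  proof (rule open_vimage[OF U(1)])
    show "continuous_on UNIV h"
      by (rule is_C2_on_continuous[OF h])
  qed
  moreover have "\<phi>' (h x) o\<^sub>L h' x \<noteq> 0" if "x \<in> h -` U" for x
  proof
    assume "\<phi>' (h x) o\<^sub>L h' x = 0"
    then have "\<phi>' (h x) (h' x (g' (h x) v)) = 0" for v
      by (metis blinfun_apply_blinfun_compose zero_blinfun.rep_eq)
    then have "\<phi>' (h x) = 0" by (auto simp: inv intro: blinfun_eqI)
    then show False using U(4) that by auto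
  qed
  moreover have "g ` S \<inter> h -` U = {x \<in> h -` U. (\<phi> \<circ> h) x = 0}"
  proof -
    have "x \<in> g ` S \<longleftrightarrow> h x \<in> S" for x using hg by (metis image_iff)
    then show ?thesis using U(5) by auto
  qed
  ultimately show "\<exists>U \<phi> \<phi>' \<phi>''. open U \<and> p \<in> U \<and> is_C2_on U \<phi> \<phi>' \<phi>'' \<and> (\<forall>x\<in>U. \<phi>' x \<noteq> 0) \<and>
        g ` S \<inter> U = {x\<in>U. \<phi> x = (0::real)}"
    using is_C2_on_compose[OF U(3) h] U(2) by blast
qed

section \<open>Functions with small global C2 norm\<close>

text \<open>\<open>G x\<close> is the gradient of \<open>\<psi>\<close> and \<open>H x\<close> its Hessian, acting as an operator on vectors.\<close>
definition C2_gradient :: "('a::euclidean_space \<Rightarrow> real) \<Rightarrow> ('a \<Rightarrow> 'a) \<Rightarrow> ('a \<Rightarrow> 'a \<Rightarrow> 'a) \<Rightarrow> bool" where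
  "C2_gradient \<psi> G H \<longleftrightarrow>
     (\<forall>x. (\<psi> has_derivative (\<lambda>h. h \<bullet> G x)) (at x)) \<and> (\<forall>x. (G has_derivative H x) (at x)) \<and>
     (\<forall>h. continuous_on UNIV (\<lambda>x. H x h))"

text \<open>The Hessian is measured in operator norm. Hiding the derivatives lets the parts of the
  perturbation be added by the triangle inequality alone.\<close>

definition C2_bounded :: "('a::euclidean_space \<Rightarrow> real) \<Rightarrow> real \<Rightarrow> bool" where
  "C2_bounded \<psi> \<delta> \<longleftrightarrow> (\<exists>G H. C2_gradient \<psi> G H \<and>
     (\<forall>x h. \<bar>\<psi> x\<bar> \<le> \<delta> \<and> norm (G x) \<le> \<delta> \<and> norm (H x h) \<le> \<delta> * norm h))"

lemma C2_gradient_add: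
  assumes "C2_gradient \<psi> G H" "C2_gradient \<psi>' G' H'"
  shows "C2_gradient (\<lambda>x. \<psi> x + \<psi>' x) (\<lambda>x. G x + G' x) (\<lambda>x h. H x h + H' x h)"
  using assms unfolding C2_gradient_def
  by (auto intro!: has_derivative_add continuous_intros simp: inner_add_right)

lemma C2_gradient_const: "C2_gradient (\<lambda>_. c) (\<lambda>_. 0) (\<lambda>_ _. 0)"
  unfolding C2_gradient_def by auto

lemma C2_gradient_sum:
  assumes "finite Z" "\<And>z. z \<in> Z \<Longrightarrow> C2_gradient (\<psi> z) (G z) (H z)"
  shows "C2_gradient (\<lambda>x. \<Sum>z\<in>Z. \<psi> z x) (\<lambda>x. \<Sum>z\<in>Z. G z x) (\<lambda>x h. \<Sum>z\<in>Z. H z x h)"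
  using assms
proof (induction Z)
  case empty
  then show ?case by (simp add: C2_gradient_const)
next
  case (insert z Z)
  then have "C2_gradient (\<psi> z) (G z) (H z)" 
     "C2_gradient (\<lambda>x. \<Sum>z\<in>Z. \<psi> z x) (\<lambda>x. \<Sum>z\<in>Z. G z x) (\<lambda>x h. \<Sum>z\<in>Z. H z x h)" by auto
  from C2_gradient_add[OF this] show ?case using insert by simp
qed

lemma C2_gradient_scale:
  assumes "C2_gradient \<psi> G H"
  shows "C2_gradient (\<lambda>x. c * \<psi> x) (\<lambda>x. c *\<^sub>R G x) (\<lambda>x h. c *\<^sub>R H x h)"
  using assms unfolding C2_gradient_def
  by (auto intro!: has_derivative_scaleR_right has_derivative_mult_right continuous_intros)

lemma C2_bounded_add:
  assumes "C2_bounded \<psi> \<delta>" "C2_bounded \<psi>' \<delta>'"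
  shows "C2_bounded (\<lambda>x. \<psi> x + \<psi>' x) (\<delta> + \<delta>')"
proof -
  obtain G H where 1: "C2_gradient \<psi> G H"
    "\<And>x h. \<bar>\<psi> x\<bar> \<le> \<delta> \<and> norm (G x) \<le> \<delta> \<and> norm (H x h) \<le> \<delta> * norm h"
    using assms(1) unfolding C2_bounded_def by blast
  obtain G' H' where 2: "C2_gradient \<psi>' G' H'"
    "\<And>x h. \<bar>\<psi>' x\<bar> \<le> \<delta>' \<and> norm (G' x) \<le> \<delta>' \<and> norm (H' x h) \<le> \<delta>' * norm h"
    using assms(2) unfolding C2_bounded_def by blast
  have "\<bar>\<psi> x + \<psi>' x\<bar> \<le> \<delta> + \<delta>' \<and> norm (G x + G' x) \<le> \<delta> + \<delta>' \<and> norm (H x h + H' x h) \<le> (\<delta> + \<delta>') * norm h"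
    for x h
    using 1(2)[of x h] 2(2)[of x h] unfolding distrib_right by (auto intro!: norm_triangle_le add_mono)
  then show ?thesis using C2_gradient_add[OF 1(1) 2(1)] unfolding C2_bounded_def by blast
qed

lemma C2_bounded_const: "\<bar>c\<bar> \<le> \<delta> \<Longrightarrow> C2_bounded (\<lambda>_. c) \<delta>"
  unfolding C2_bounded_def using C2_gradient_const[of c] by force

lemma C2_bounded_sum:
  assumes "finite Z" "\<And>z. z \<in> Z \<Longrightarrow> C2_bounded (\<psi> z) \<delta>"
  shows "C2_bounded (\<lambda>x. \<Sum>z\<in>Z. \<psi> z x) (real (card Z) * \<delta>)"
  using assms
proof (induction Z)
  case empty
  then show ?case by (simp add: C2_bounded_const)
next
  case (insert z Z)
  then show ?case using C2_bounded_add[of "\<psi> z" \<delta>] by (simp add: distrib_right)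
qed

lemma C2_bounded_sin:
  fixes b :: "'a::euclidean_space"
  assumes "norm b = 1" "\<bar>\<tau>\<bar> \<le> \<delta>"
  shows "C2_bounded (\<lambda>x. \<tau> * sin (x \<bullet> b - p)) \<delta>"
proof -
  define G where "G = (\<lambda>x. (\<tau> * cos (x \<bullet> b - p)) *\<^sub>R b)"
  define H where "H = (\<lambda>x h. (- \<tau> * sin (x \<bullet> b - p) * (h \<bullet> b)) *\<^sub>R b)"
  have "C2_gradient (\<lambda>x. \<tau> * sin (x \<bullet> b - p)) G H"
    unfolding C2_gradient_def G_def H_def
    by (auto intro!: derivative_eq_intros continuous_intros simp: inner_commute algebra_simps)
  moreover have "\<bar>\<tau> * sin (x \<bullet> b - p)\<bar> \<le> \<delta> \<and> norm (G x) \<le> \<delta> \<and> norm (H x h) \<le> \<delta> * norm h" for x h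
  proof -
    have t: "\<bar>\<tau>\<bar> * \<bar>sin y\<bar> \<le> \<delta>" "\<bar>\<tau>\<bar> * \<bar>cos y\<bar> \<le> \<delta>" for y
      using assms(2) abs_sin_le_one[of y] abs_cos_le_one[of y]
      by (smt (verit) mult_left_le abs_ge_zero)+
    have "\<bar>h \<bullet> b\<bar> \<le> norm h" using Cauchy_Schwarz_ineq2[of h b] assms by simp
    then have "\<bar>\<tau>\<bar> * \<bar>sin (x \<bullet> b - p)\<bar> * \<bar>h \<bullet> b\<bar> \<le> \<delta> * norm h"
      using t assms by (intro mult_mono) auto
    then show ?thesis using t assms by (auto simp: G_def H_def abs_mult)
  qed
  ultimately show ?thesis unfolding C2_bounded_def by blast
qed

section \<open>Disjoint cubic bumps\<close>

text \<open>Away from 0 the function agrees locally with 0 or with a power. At the kink,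
  \<open>n \<ge> 2\<close> makes it at most \<open>\<bar>y\<bar> ^ 2\<close> near 0, so the
  difference quotient tends to 0.\<close>

lemma has_derivative_max0_power:
  assumes "2 \<le> n"
  shows "((\<lambda>u::real. max 0 u ^ n) has_derivative (\<lambda>h. h * (real n * max 0 u ^ (n - 1)))) (at u)"
proof -
  consider "u < 0" | "u > 0" | "u = 0" by linarith
  then show ?thesis
  proof cases
    case 1
    have "((\<lambda>u::real. 0) has_derivative (\<lambda>h. 0)) (at u)" by simp
    then have "((\<lambda>u::real. max 0 u ^ n) has_derivative (\<lambda>h. 0)) (at u)"
      by (rule has_derivative_transform_within_open[where s = "{..<0}"]) (use 1 assms in auto)
    moreover have "max 0 u ^ (n - 1) = 0" using 1 assms by simp
    ultimately show ?thesis by (simp only: mult_zero_right)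
  next
    case 2
    have "((\<lambda>u::real. u ^ n) has_derivative (\<lambda>h. h * (real n * u ^ (n - 1)))) (at u)"
      by (auto intro!: derivative_eq_intros)
    then have "((\<lambda>u::real. max 0 u ^ n) has_derivative (\<lambda>h. h * (real n * u ^ (n - 1)))) (at u)"
      by (rule has_derivative_transform_within_open[where s = "{0<..}"]) (use 2 in auto)
    then show ?thesis using 2 by (simp add: max_def)
  next
    case 3
    have "((\<lambda>u::real. max 0 u ^ n) has_derivative (\<lambda>h. 0)) (at 0)"
    proof (rule has_derivativeI_sandwich[of 1 _ _ _ _ "\<lambda>y. \<bar>y\<bar>"])
      show "(\<lambda>y::real. \<bar>y\<bar>) \<midarrow>0\<rightarrow> 0" using tendsto_rabs_zero[OF tendsto_ident_at] by simp
      fix y :: real assume y: "y \<noteq> 0" "dist y 0 < 1"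
      have "max 0 y ^ n \<le> \<bar>y\<bar> ^ 2"
      proof -
        have "max 0 y ^ n \<le> \<bar>y\<bar> ^ n" by (intro power_mono) auto
        also have "\<dots> \<le> \<bar>y\<bar> ^ 2" using y assms by (intro power_decreasing) auto
        finally show ?thesis .
      qed
      then show "norm (max 0 y ^ n - max 0 0 ^ n - 0) / norm (y - 0) \<le> \<bar>y\<bar>"
        using y assms by (simp add: power2_eq_square field_simps zero_power)
    qed auto
    moreover have "max 0 u ^ (n - 1) = 0" using 3 assms by simp
    ultimately show ?thesis using 3 by (simp only: mult_zero_right)
  qed
qed


text \<open>The cube is the least integer power of the positive part with a continuous Hessian.
  \<open>P\<close> projects along \<open>e\<close>, so the support is a cylinder over a ball around
  \<open>z\<close>; as \<open>z\<close> is orthogonal to \<open>e\<close>, so is \<open>y x\<close>,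
  and hence \<open>y x \<bullet> P h\<close> simplifies to \<open>y x \<bullet> h\<close>.\<close>

lemma C2_gradient_bump:
  fixes e z :: "'a::euclidean_space" and r :: real
  assumes e: "norm e = 1" and z: "z \<bullet> e = 0"
  defines "P \<equiv> \<lambda>x. x - (x \<bullet> e) *\<^sub>R e"
  defines "y \<equiv> \<lambda>x. P x - z"
  defines "u \<equiv> \<lambda>x. 1 - (y x \<bullet> y x) / r\<^sup>2"
  shows "C2_gradient (\<lambda>x. max 0 (u x) ^ 3) (\<lambda>x. (- 6 / r\<^sup>2 * max 0 (u x) ^ 2) *\<^sub>R y x)
    (\<lambda>x h. (24 / (r\<^sup>2 * r\<^sup>2) * max 0 (u x) * (y x \<bullet> h)) *\<^sub>R y x - (6 / r\<^sup>2 * max 0 (u x) ^ 2) *\<^sub>R P h)"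
proof -
  have ee: "e \<bullet> e = 1" using e by (simp add: norm_eq_1)
  have ye: "y x \<bullet> e = 0" for x using ee z by (simp add: y_def P_def inner_diff_left)
  have dy: "(y has_derivative P) (at x)" for x
    unfolding y_def P_def by (auto intro!: derivative_eq_intros)
  have yP: "y x \<bullet> P h = y x \<bullet> h" "P h \<bullet> y x = y x \<bullet> h" for x h
    using ye[of x] by (simp_all add: P_def inner_diff_left inner_diff_right inner_commute)
  have du: "(u has_derivative (\<lambda>h. - 2 / r\<^sup>2 * (y x \<bullet> h))) (at x)" for x
  proof -
    have "((\<lambda>x. y x \<bullet> y x) has_derivative (\<lambda>h. 2 * (y x \<bullet> h))) (at x)"
      using has_derivative_inner[OF dy[of x] dy[of x]] by (simp add: yP)
    from has_derivative_diff[OF has_derivative_const[of 1] has_derivative_mult_left[OF this, of "inverse (r\<^sup>2)"]]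
    show ?thesis unfolding u_def divide_inverse by (rule has_derivative_eq_rhs) auto
  qed
  have cu: "continuous_on UNIV u" and cy: "continuous_on UNIV y"
    using du dy by (auto intro!: continuous_at_imp_continuous_on has_derivative_continuous)
  have d3: "((\<lambda>x. max 0 (u x) ^ 3) has_derivative (\<lambda>h. (- 2 / r\<^sup>2 * (y x \<bullet> h)) * (3 * max 0 (u x) ^ 2))) (at x)" for x
    using has_derivative_compose[OF du has_derivative_max0_power[of 3]] by simp
  have d2: "((\<lambda>x. max 0 (u x) ^ 2) has_derivative (\<lambda>h. (- 2 / r\<^sup>2 * (y x \<bullet> h)) * (2 * max 0 (u x)))) (at x)" for x
    using has_derivative_compose[OF du has_derivative_max0_power[of 2]] by simp
  have "((\<lambda>x. max 0 (u x) ^ 3) has_derivative (\<lambda>h. h \<bullet> ((- 6 / r\<^sup>2 * max 0 (u x) ^ 2) *\<^sub>R y x))) (at x)" for x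
    by (rule has_derivative_eq_rhs[OF d3]) (auto simp: inner_commute)
  moreover have "((\<lambda>x. (- 6 / r\<^sup>2 * max 0 (u x) ^ 2) *\<^sub>R y x) has_derivative
    (\<lambda>h. (24 / (r\<^sup>2 * r\<^sup>2) * max 0 (u x) * (y x \<bullet> h)) *\<^sub>R y x - (6 / r\<^sup>2 * max 0 (u x) ^ 2) *\<^sub>R P h)) (at x)" for x
    by (rule has_derivative_eq_rhs[OF has_derivative_scaleR[OF has_derivative_mult_right[OF d2] dy]])
      (auto simp: field_simps)
  moreover have "continuous_on UNIV (\<lambda>x. (24 / (r\<^sup>2 * r\<^sup>2) * max 0 (u x) * (y x \<bullet> h)) *\<^sub>R y x - (6 / r\<^sup>2 * max 0 (u x) ^ 2) *\<^sub>R P h)" for h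
    by (intro continuous_intros cu cy)
  ultimately show ?thesis unfolding C2_gradient_def by blast
qed

text \<open>For functions with disjoint supports this bounds the sum by the size of one term,
  independently of their number, which for the bumps grows with \<open>R\<close>.\<close>

lemma norm_sum_le_at_most_one:
  fixes f :: "'b \<Rightarrow> 'a::real_normed_vector"
  assumes "finite Z" "0 \<le> K" "\<And>z. z \<in> Z \<Longrightarrow> norm (f z) \<le> K"
    and "\<And>z z'. \<lbrakk>z \<in> Z; z' \<in> Z; f z \<noteq> 0; f z' \<noteq> 0\<rbrakk> \<Longrightarrow> z = z'"
  shows "norm (\<Sum>z\<in>Z. f z) \<le> K"
proof (cases "\<exists>z\<in>Z. f z \<noteq> 0")
  case True
  then obtain z where z: "z \<in> Z" "f z \<noteq> 0" by blast
  have "(\<Sum>z\<in>Z. f z) = (\<Sum>z\<in>{z}. f z)"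
    using assms z by (intro sum.mono_neutral_right) auto
  then show ?thesis using assms z by simp
next
  case False
  then show ?thesis using assms by simp
qed

text \<open>One bump of radius \<open>r\<close> is put at each point of \<open>Z\<close>, with
  height \<open>\<sigma> z\<close>. Separation \<open>2 * r\<close> makes the supporting cylinders
  disjoint. Two derivatives cost a factor of order \<open>1 / r\<^sup>2\<close>, which the bound on
  \<open>\<sigma>\<close> compensates.\<close>

lemma exists_C2_bounded_interpolation:
  fixes e :: "'a::euclidean_space" and \<sigma> :: "'a \<Rightarrow> real"
  assumes e: "norm e = 1" and Z: "finite Z" "\<And>z. z \<in> Z \<Longrightarrow> z \<bullet> e = 0"
    and sep: "\<And>z z'. \<lbrakk>z \<in> Z; z' \<in> Z; z \<noteq> z'\<rbrakk> \<Longrightarrow> 2 * r \<le> norm (z - z')"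
    and r: "0 < r" "r \<le> 1" and \<sigma>: "\<And>z. z \<in> Z \<Longrightarrow> \<bar>\<sigma> z\<bar> \<le> \<kappa> * r\<^sup>2" and \<kappa>: "0 \<le> \<kappa>"
  obtains \<psi> where "C2_bounded \<psi> (30 * \<kappa>)" "\<And>z. z \<in> Z \<Longrightarrow> \<psi> z = \<sigma> z" "\<And>x s. \<psi> (x + s *\<^sub>R e) = \<psi> x"
proof -
  define P where "P = (\<lambda>x. x - (x \<bullet> e) *\<^sub>R e)"
  define y where "y = (\<lambda>z x. P x - z)"
  define u where "u = (\<lambda>z x. 1 - (y z x \<bullet> y z x) / r\<^sup>2)"
  define \<psi> where "\<psi> = (\<lambda>z x. \<sigma> z * max 0 (u z x) ^ 3)"
  define G where "G = (\<lambda>z x. \<sigma> z *\<^sub>R (- 6 / r\<^sup>2 * max 0 (u z x) ^ 2) *\<^sub>R y z x)"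
  define H where "H = (\<lambda>z x h. \<sigma> z *\<^sub>R ((24 / (r\<^sup>2 * r\<^sup>2) * max 0 (u z x) * (y z x \<bullet> h)) *\<^sub>R y z x
     - (6 / r\<^sup>2 * max 0 (u z x) ^ 2) *\<^sub>R P h))"
  have ee: "e \<bullet> e = 1" using e by (simp add: norm_eq_1)
  have C: "C2_gradient (\<psi> z) (G z) (H z)" if "z \<in> Z" for z
    unfolding \<psi>_def G_def H_def u_def y_def P_def
    by (rule C2_gradient_scale[OF C2_gradient_bump[OF e Z(2)[OF that]]])
  have r2: "r\<^sup>2 \<le> r" "0 < r\<^sup>2" using r by (auto simp: power2_eq_square mult_left_le)
  have close: "norm (y z x) < r" if "max 0 (u z x) \<noteq> 0" for z x
  proof -
    have "0 < u z x" using that by (simp add: max_def split: if_splits)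
    then have "(y z x \<bullet> y z x) / r\<^sup>2 < 1" by (simp add: u_def)
    then have "(norm (y z x))\<^sup>2 < r\<^sup>2" using r2 by (simp add: power2_norm_eq_inner)
    then show ?thesis using r by (simp add: power_less_imp_less_base)
  qed
  have u01: "0 \<le> max 0 (u z x)" "max 0 (u z x) \<le> 1" for z x
    by (auto simp: u_def)
  have uniq: "z = z'" if "z \<in> Z" "z' \<in> Z" "max 0 (u z x) \<noteq> 0" "max 0 (u z' x) \<noteq> 0" for z z' x
  proof (rule ccontr)
    assume "z \<noteq> z'"
    have "norm (z - z') = norm (y z' x - y z x)" by (simp add: y_def)
    also have "\<dots> < 2 * r" using norm_triangle_ineq4[of "y z' x" "y z x"] close[OF that(3)] close[OF that(4)] by linarith
    finally show False using sep[OF that(1,2) \<open>z \<noteq> z'\<close>] by simp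
  qed
  have \<sigma>6: "\<bar>\<sigma> z\<bar> * (c / r\<^sup>2) \<le> c * \<kappa>" if "z \<in> Z" "0 \<le> c" for z c
  proof -
    have "\<bar>\<sigma> z\<bar> * (c / r\<^sup>2) \<le> (\<kappa> * r\<^sup>2) * (c / r\<^sup>2)" using \<sigma> that r2 by (intro mult_right_mono) auto
    then show ?thesis using r2 by (simp add: mult.commute)
  qed
  have normP: "norm (P h) \<le> norm h" for h
  proof -
    have "(norm (P h))\<^sup>2 = (norm h)\<^sup>2 - (h \<bullet> e)\<^sup>2"
      by (simp add: power2_norm_eq_inner P_def inner_diff_left inner_diff_right ee inner_commute)
        (simp add: power2_eq_square)
    then have "(norm (P h))\<^sup>2 \<le> (norm h)\<^sup>2" by simp
    then show ?thesis by (rule power2_le_imp_le) simp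
  qed
  have b0: "norm (\<psi> z x) \<le> 30 * \<kappa>" if "z \<in> Z" for z x
  proof -
    have "\<kappa> * r\<^sup>2 \<le> \<kappa> * 1" using r2 r \<kappa> by (intro mult_left_mono) auto
    then have "\<bar>\<sigma> z\<bar> \<le> \<kappa> * 1" using \<sigma>[OF that] by linarith
    moreover have "max 0 (u z x) ^ 3 \<le> 1" using u01 by (simp add: power_le_one)
    ultimately have "\<bar>\<sigma> z\<bar> * max 0 (u z x) ^ 3 \<le> \<kappa> * 1"
      using u01 \<kappa> by (intro mult_mono) auto
    then show ?thesis using \<kappa> u01[of z x] by (simp add: \<psi>_def abs_mult)
  qed
  have b1: "norm (G z x) \<le> 30 * \<kappa>" if "z \<in> Z" for z x
  proof (cases "max 0 (u z x) = 0")
    case True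
    then show ?thesis using \<kappa> by (simp add: G_def)
  next
    case False
    have "max 0 (u z x) ^ 2 * norm (y z x) \<le> 1 * 1"
      using u01[of z x] close[OF False] r by (intro mult_mono power_le_one) auto
    then have "\<bar>\<sigma> z\<bar> * (6 / r\<^sup>2) * (max 0 (u z x) ^ 2 * norm (y z x)) \<le> \<bar>\<sigma> z\<bar> * (6 / r\<^sup>2) * 1"
      by (intro mult_left_mono) auto
    then show ?thesis using \<sigma>6[OF that, of 6] \<kappa> by (simp add: G_def abs_mult mult.assoc)
  qed
  \<comment> \<open>On the support \<open>norm (y z x) < r\<close>, so the rank-one part of the
    Hessian contributes 24 and the projection part 6, each times \<open>\<kappa>\<close>. This is
    the origin of 30; values and gradients are smaller because \<open>r \<le> 1\<close>.\<close>
  have b2: "norm (H z x h) \<le> 30 * \<kappa> * norm h" if "z \<in> Z" for z x h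
  proof (cases "max 0 (u z x) = 0")
    case True
    then show ?thesis using \<kappa> by (simp add: H_def)
  next
    case False
    have "\<bar>y z x \<bullet> h\<bar> * norm (y z x) \<le> (r * norm h) * r"
    proof (rule mult_mono)
      show "\<bar>y z x \<bullet> h\<bar> \<le> r * norm h"
        using Cauchy_Schwarz_ineq2[of "y z x" h] close[OF False]
        by (meson less_imp_le mult_right_mono norm_ge_zero order_trans)
    qed (use close[OF False] r in auto)
    then have "max 0 (u z x) * (\<bar>y z x \<bullet> h\<bar> * norm (y z x)) \<le> 1 * (r\<^sup>2 * norm h)"
      using u01[of z x] mult_mono[of "max 0 (u z x)" 1 "\<bar>y z x \<bullet> h\<bar> * norm (y z x)" "r\<^sup>2 * norm h"]
      by (simp add: power2_eq_square mult_ac)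
    then have "24 / (r\<^sup>2 * r\<^sup>2) * (max 0 (u z x) * (\<bar>y z x \<bullet> h\<bar> * norm (y z x))) \<le> 24 / (r\<^sup>2 * r\<^sup>2) * (1 * (r\<^sup>2 * norm h))"
      by (intro mult_left_mono) auto
    also have "\<dots> = 24 / r\<^sup>2 * norm h"
    proof -
      have "24 / (w * w) * (1 * (w * n)) = 24 / w * n" if "0 < w" for w n :: real using that by simp
      from this[OF r2(2)] show ?thesis .
    qed
    finally have 1: "24 / (r\<^sup>2 * r\<^sup>2) * (max 0 (u z x) * (\<bar>y z x \<bullet> h\<bar> * norm (y z x))) \<le> 24 / r\<^sup>2 * norm h" .
    have "max 0 (u z x) ^ 2 * norm (P h) \<le> 1 * norm h"
      using u01[of z x] normP by (intro mult_mono power_le_one) auto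
    then have 2: "6 / r\<^sup>2 * (max 0 (u z x) ^ 2 * norm (P h)) \<le> 6 / r\<^sup>2 * norm h"
      using mult_left_mono[of _ _ "6 / r\<^sup>2"] by simp
    have "norm ((24 / (r\<^sup>2 * r\<^sup>2) * max 0 (u z x) * (y z x \<bullet> h)) *\<^sub>R y z x) \<le> 24 / r\<^sup>2 * norm h"
      using 1 by (simp add: abs_mult mult_ac)
    moreover have "norm ((6 / r\<^sup>2 * max 0 (u z x) ^ 2) *\<^sub>R P h) \<le> 6 / r\<^sup>2 * norm h"
      using 2 by (simp add: abs_mult mult_ac)
    ultimately have "norm ((24 / (r\<^sup>2 * r\<^sup>2) * max 0 (u z x) * (y z x \<bullet> h)) *\<^sub>R y z x
     - (6 / r\<^sup>2 * max 0 (u z x) ^ 2) *\<^sub>R P h) \<le> 24 / r\<^sup>2 * norm h + 6 / r\<^sup>2 * norm h"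
      by (meson add_mono norm_triangle_ineq4 order_trans)
    also have "\<dots> = 30 / r\<^sup>2 * norm h" by (simp add: field_simps)
    finally have "norm (H z x h) \<le> \<bar>\<sigma> z\<bar> * (30 / r\<^sup>2 * norm h)"
      unfolding H_def norm_scaleR by (rule mult_left_mono) simp
    also have "\<dots> = \<bar>\<sigma> z\<bar> * (30 / r\<^sup>2) * norm h" by simp
    also have "\<dots> \<le> 30 * \<kappa> * norm h"
      using \<sigma>6[OF that, of 30] by (intro mult_right_mono) auto
    finally show ?thesis .
  qed
  show thesis
  proof (rule that[of "\<lambda>x. \<Sum>z\<in>Z. \<psi> z x"])
    have "norm (\<Sum>z\<in>Z. \<psi> z x) \<le> 30 * \<kappa>" for x
      by (rule norm_sum_le_at_most_one[OF Z(1)]) (use \<kappa> b0 uniq in \<open>auto simp: \<psi>_def\<close>)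
    moreover have "norm (\<Sum>z\<in>Z. G z x) \<le> 30 * \<kappa>" for x
      by (rule norm_sum_le_at_most_one[OF Z(1)]) (use \<kappa> b1 uniq in \<open>auto simp: G_def\<close>)
    moreover have "norm (\<Sum>z\<in>Z. H z x h) \<le> 30 * \<kappa> * norm h" for x h
    proof (rule norm_sum_le_at_most_one[OF Z(1)])
      show "z = z'" if "z \<in> Z" "z' \<in> Z" "H z x h \<noteq> 0" "H z' x h \<noteq> 0" for z z'
      proof (rule uniq[OF that(1,2)])
        show "max 0 (u z x) \<noteq> 0" "max 0 (u z' x) \<noteq> 0"
          using that(3,4) unfolding H_def by (metis (no_types, lifting) diff_self mult_zero_left mult_zero_right power_zero_numeral scaleR_zero_left scaleR_zero_right)+
      qed
    qed (use \<kappa> b2 in auto)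
    moreover have "C2_gradient (\<lambda>x. \<Sum>z\<in>Z. \<psi> z x) (\<lambda>x. \<Sum>z\<in>Z. G z x) (\<lambda>x h. \<Sum>z\<in>Z. H z x h)"
      by (rule C2_gradient_sum[OF Z(1) C])
    ultimately show "C2_bounded (\<lambda>x. \<Sum>z\<in>Z. \<psi> z x) (30 * \<kappa>)"
      unfolding C2_bounded_def real_norm_def by blast
  next
    fix z assume z: "z \<in> Z"
    have Pz: "P z = z" using Z(2)[OF z] by (simp add: P_def)
    have uz: "u z z = 1" by (simp add: u_def y_def Pz)
    \<comment> \<open>At a centre all other bumps vanish, and its own bump has its full height
      there.\<close>
    have "(\<Sum>z'\<in>Z. \<psi> z' z) = (\<Sum>z'\<in>{z}. \<psi> z' z)"
    proof (rule sum.mono_neutral_right[OF Z(1)])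
      show "\<forall>z'\<in>Z - {z}. \<psi> z' z = 0"
        using uniq[OF z, of _ z] uz by (force simp: \<psi>_def)
    qed (use z in auto)
    then show "(\<Sum>z'\<in>Z. \<psi> z' z) = \<sigma> z" by (simp add: \<psi>_def uz)
  next
    fix x s
    have "P (x + s *\<^sub>R e) = P x" by (simp add: P_def inner_add_left ee algebra_simps)
    then show "(\<Sum>z\<in>Z. \<psi> z (x + s *\<^sub>R e)) = (\<Sum>z\<in>Z. \<psi> z x)" by (simp add: \<psi>_def u_def y_def)
  qed
qed

section \<open>Shears along a unit vector\<close>

lemma is_C2_on_shear:
  fixes e :: "'a::euclidean_space"
  assumes e: "norm e = 1" and \<psi>: "C2_bounded \<psi> \<delta>"
  obtains g' g'' where "is_C2_on UNIV (\<lambda>x. x + \<psi> x *\<^sub>R e) g' g''"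
    "\<And>x. norm (g' x - id_blinfun) \<le> \<delta>" "\<And>x. norm (g'' x) \<le> \<delta>"
proof -
  obtain G H where GH: "C2_gradient \<psi> G H"
    and bd: "\<And>x h. \<bar>\<psi> x\<bar> \<le> \<delta> \<and> norm (G x) \<le> \<delta> \<and> norm (H x h) \<le> \<delta> * norm h"
    using \<psi> unfolding C2_bounded_def by blast
  have \<delta>: "0 \<le> \<delta>" using bd by (meson abs_ge_zero order_trans)
  \<comment> \<open>\<open>E v\<close> is the rank-one operator with image spanned by
    \<open>e\<close>. It is linear in \<open>v\<close> and does not increase the norm, so bounds on
    the gradient and Hessian pass unchanged to the derivatives of the shear.\<close>
  define E where "E = (\<lambda>v::'a. blinfun_scaleR_left e o\<^sub>L blinfun_inner_left v)"
  have E: "E v h = (h \<bullet> v) *\<^sub>R e" for v h by (simp add: E_def)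
  have blE: "bounded_linear E"
    unfolding E_def
    by (intro bounded_linear_compose[OF bounded_bilinear.bounded_linear_right[OF bounded_bilinear_blinfun_compose]]
        bounded_linear_blinfun_inner_left)
  have nE: "norm (E v) \<le> norm v" for v
    by (rule norm_blinfun_bound) (use Cauchy_Schwarz_ineq2[of _ v] in \<open>auto simp: E e mult.commute\<close>)
  define g' where "g' = (\<lambda>x. id_blinfun + E (G x))"
  define g'' where "g'' = (\<lambda>x. Blinfun (\<lambda>h. E (H x h)))"
  have dG: "(G has_derivative H x) (at x)" for x using GH by (auto simp: C2_gradient_def)
  have dE: "((\<lambda>x. E (G x)) has_derivative (\<lambda>h. E (H x h))) (at x)" for x
    by (rule bounded_linear.has_derivative[OF blE dG])
  have g'': "blinfun_apply (g'' x) = (\<lambda>h. E (H x h))" for x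
    unfolding g''_def using dE has_derivative_bounded_linear bounded_linear_Blinfun_apply by blast
  have "((\<lambda>x. x + \<psi> x *\<^sub>R e) has_derivative blinfun_apply (g' x)) (at x)" for x
  proof -
    have "(\<psi> has_derivative (\<lambda>h. h \<bullet> G x)) (at x)" using GH by (auto simp: C2_gradient_def)
    from has_derivative_add[OF has_derivative_ident has_derivative_scaleR_left[OF this]]
    show ?thesis by (rule has_derivative_eq_rhs) (auto simp: g'_def blinfun.add_left E)
  qed
  moreover have "(g' has_derivative blinfun_apply (g'' x)) (at x)" for x
    unfolding g'_def g'' using has_derivative_add[OF has_derivative_const dE] by simp
  moreover have "continuous_on UNIV g''"
  proof (rule continuous_on_blinfun_componentwise)
    fix i :: 'a
    have "continuous_on UNIV (\<lambda>x. H x i)" using GH by (auto simp: C2_gradient_def)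
    then show "continuous_on UNIV (\<lambda>x. g'' x i)"
      unfolding g'' by (rule bounded_linear.continuous_on[OF blE])
  qed
  ultimately have "is_C2_on UNIV (\<lambda>x. x + \<psi> x *\<^sub>R e) g' g''" by (auto simp: is_C2_on_def)
  moreover have "norm (g' x - id_blinfun) \<le> \<delta>" for x
    using order_trans[OF nE[of "G x"]] bd[of x 0] by (simp add: g'_def)
  moreover have "norm (g'' x) \<le> \<delta>" for x
    by (rule norm_blinfun_bound[OF \<delta>]) (use nE bd in \<open>auto simp: g'' intro: order_trans\<close>)
  ultimately show ?thesis using that by blast
qed

lemma c2_close_shear:
  fixes e :: "real^'n"
  assumes S: "c2_hypersurface S" and e: "norm e = 1" and \<psi>: "C2_bounded \<psi> \<delta>" "\<delta> < \<epsilon>"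
    and inv: "\<And>x s. \<psi> (x + s *\<^sub>R e) = \<psi> x"
  shows "c2_hypersurface ((\<lambda>x. x + \<psi> x *\<^sub>R e) ` S)" "c2_close S ((\<lambda>x. x + \<psi> x *\<^sub>R e) ` S) \<epsilon>"
proof -
  obtain g' g'' where g: "is_C2_on UNIV (\<lambda>x. x + \<psi> x *\<^sub>R e) g' g''"
    "\<And>x. norm (g' x - id_blinfun) \<le> \<delta>" "\<And>x. norm (g'' x) \<le> \<delta>"
    using is_C2_on_shear[OF e \<psi>(1)] by blast
  \<comment> \<open>The inverse is the shear by the same \<open>\<psi>\<close> along
    \<open>- e\<close>, so its regularity comes from the same lemma.\<close>
  have "norm (- e) = 1" using e by simp
  then obtain h' h'' where h: "is_C2_on UNIV (\<lambda>x. x + \<psi> x *\<^sub>R (- e)) h' h''"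
    using is_C2_on_shear \<psi>(1) by blast
  have inv': "\<psi> (x - s *\<^sub>R e) = \<psi> x" for x s using inv[of x "- s"] by simp
  have hg: "x + \<psi> x *\<^sub>R e + \<psi> (x + \<psi> x *\<^sub>R e) *\<^sub>R - e = x" "x + \<psi> x *\<^sub>R - e + \<psi> (x + \<psi> x *\<^sub>R - e) *\<^sub>R e = x" for x
    by (simp_all add: inv inv')
  show "c2_hypersurface ((\<lambda>x. x + \<psi> x *\<^sub>R e) ` S)"
    by (rule c2_hypersurface_image[OF S g(1) h]) (rule hg)+
  have "norm (x + \<psi> x *\<^sub>R e - x) \<le> \<delta>" for x
    using \<psi>(1) e by (auto simp: C2_bounded_def)
  then show "c2_close S ((\<lambda>x. x + \<psi> x *\<^sub>R e) ` S) \<epsilon>"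
    unfolding c2_close_def using g h hg \<psi>(2)
    by (intro exI[of _ "\<lambda>x. x + \<psi> x *\<^sub>R e"] exI[of _ g'] exI[of _ g''] exI[of _ "\<lambda>x. x + \<psi> x *\<^sub>R - e"]
        exI[of _ h'] exI[of _ h''] conjI exI[of _ \<delta>]) auto
qed

section \<open>Lattice points on a perturbed hypersurface\<close>

lemma c2_hypersurface_vertical_point:
  fixes S :: "(real^'n) set"
  assumes "c2_hypersurface S" "p \<in> S"
  obtains k :: 'n and \<rho> where "0 < \<rho>"
    "\<And>y. \<lbrakk>y $ k = 0; \<And>i. i \<noteq> k \<Longrightarrow> \<bar>y $ i - p $ i\<bar> \<le> \<rho>\<rbrakk> \<Longrightarrow> \<exists>s. y + s *\<^sub>R axis k 1 \<in> S"
proof -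
  obtain U and \<phi> :: "real^'n \<Rightarrow> real" and \<phi>' \<phi>'' where U: "open U" "p \<in> U" "is_C2_on U \<phi> \<phi>' \<phi>''"
    "\<forall>x\<in>U. \<phi>' x \<noteq> 0" "S \<inter> U = {x\<in>U. \<phi> x = 0}"
    using bspec[OF assms(1)[unfolded c2_hypersurface_def] assms(2)] by meson
  have "\<exists>k. \<phi>' p (axis k 1) \<noteq> 0"
  proof (rule ccontr)
    assume "\<not> ?thesis"
    then have "\<phi>' p = 0" by (intro blinfun_euclidean_eqI) (auto simp: Basis_vec_def)
    then show False using U(2,4) by blast
  qed
  then obtain k where k: "\<phi>' p (axis k 1) \<noteq> 0" by blast
  define e :: "real^'n" where "e = axis k 1"
  define d where "d = \<phi>' p e"
  \<comment> \<open>The sign is chosen so that \<open>\<xi>\<close> increases through 0 at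
    \<open>p\<close> in direction \<open>e\<close>.\<close>
  define \<xi> where "\<xi> = (\<lambda>x. sgn d * \<phi> x)"
  have d0: "d \<noteq> 0" using k by (simp add: d_def e_def)
  have c\<xi>: "continuous_on U \<xi>" unfolding \<xi>_def by (intro continuous_intros is_C2_on_continuous[OF U(3)])
  have "(\<phi> has_derivative blinfun_apply (\<phi>' p)) (at p)" using U(2,3) by (auto simp: is_C2_on_def)
  moreover have "((\<lambda>s. p + s *\<^sub>R e) has_derivative (\<lambda>s. s *\<^sub>R e)) (at 0)"
    by (auto intro!: derivative_eq_intros)
  ultimately have "((\<lambda>s. \<phi> (p + s *\<^sub>R e)) has_derivative (\<lambda>s. \<phi>' p (s *\<^sub>R e))) (at 0)"
    using has_derivative_compose[of "\<lambda>s. p + s *\<^sub>R e" "\<lambda>s. s *\<^sub>R e" 0 UNIV \<phi> "\<phi>' p"] by simp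
  then have "((\<lambda>s. \<xi> (p + s *\<^sub>R e)) has_derivative (\<lambda>s. sgn d * \<phi>' p (s *\<^sub>R e))) (at 0)"
    unfolding \<xi>_def by (rule has_derivative_mult_right)
  moreover have "(\<lambda>s. sgn d * \<phi>' p (s *\<^sub>R e)) = (*) \<bar>d\<bar>"
    by (auto simp: blinfun.scaleR_right d_def[symmetric] sgn_if)
  ultimately have D: "((\<lambda>s. \<xi> (p + s *\<^sub>R e)) has_real_derivative \<bar>d\<bar>) (at 0)"
    by (simp add: has_field_derivative_def)
  have \<xi>p: "\<xi> p = 0" using U(2,5) assms(2) by (auto simp: \<xi>_def)
  obtain \<delta>1 where \<delta>1: "\<delta>1 > 0" "\<And>h. 0 < h \<Longrightarrow> h < \<delta>1 \<Longrightarrow> 0 < \<xi> (p + h *\<^sub>R e)"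
    using DERIV_pos_inc_right[OF D] d0 \<xi>p by auto
  obtain \<delta>2 where \<delta>2: "\<delta>2 > 0" "\<And>h. 0 < h \<Longrightarrow> h < \<delta>2 \<Longrightarrow> \<xi> (p - h *\<^sub>R e) < 0"
    using DERIV_pos_inc_left[OF D] d0 \<xi>p by auto
  obtain \<eta> where \<eta>: "\<eta> > 0" "ball p \<eta> \<subseteq> U" using U(1,2) openE by blast
  define l where "l = min (min \<delta>1 \<delta>2) \<eta> / 2"
  have l: "0 < l" "l < \<delta>1" "l < \<delta>2" "l \<le> \<eta> / 2" using \<delta>1 \<delta>2 \<eta> by (auto simp: l_def)
  have e1: "norm e = 1" by (simp add: e_def)
  have inU: "p + s *\<^sub>R e \<in> U" if "\<bar>s\<bar> \<le> l" for s
  proof -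
    have "p + s *\<^sub>R e \<in> ball p \<eta>" using that l \<eta> e1 by (simp add: dist_norm)
    then show ?thesis using \<eta> by blast
  qed
  have near: "\<exists>\<rho>>0. \<forall>x. dist x y < \<rho> \<longrightarrow> \<xi> x \<in> W" if "y \<in> U" "open W" "\<xi> y \<in> W" for y W
  proof -
    have "open (U \<inter> \<xi> -` W)" using c\<xi> U(1) that(2) continuous_open_preimage by blast
    moreover have "y \<in> U \<inter> \<xi> -` W" using that by auto
    ultimately obtain \<rho> where "\<rho> > 0" "ball y \<rho> \<subseteq> U \<inter> \<xi> -` W" using openE by blast
    then show ?thesis by (metis IntD2 dist_commute mem_ball subsetD vimageE)
  qed
  \<comment> \<open>The signs at the endpoints \<open>p + l *\<^sub>R e\<close> and
    \<open>p - l *\<^sub>R e\<close> persist on small balls, so every nearby parallel segment also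
    has endpoints of opposite sign.\<close>
  obtain \<rho>1 where \<rho>1: "\<rho>1 > 0" "\<And>x. dist x (p + l *\<^sub>R e) < \<rho>1 \<Longrightarrow> 0 < \<xi> x"
    using near[of "p + l *\<^sub>R e" "{0<..}"] inU[of l] \<delta>1(2)[of l] l by auto
  obtain \<rho>2 where \<rho>2: "\<rho>2 > 0" "\<And>x. dist x (p - l *\<^sub>R e) < \<rho>2 \<Longrightarrow> \<xi> x < 0"
    using near[of "p - l *\<^sub>R e" "{..<0}"] inU[of "- l"] \<delta>2(2)[of l] l by auto
  \<comment> \<open>Besides preserving the signs, \<open>\<rho>0 < \<eta> / 2\<close> together with
    \<open>l \<le> \<eta> / 2\<close> keeps the moved segments inside
    \<open>ball p \<eta>\<close>.\<close>
  define \<rho>0 where "\<rho>0 = min (min \<rho>1 \<rho>2) (\<eta> / 2) / 2"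
  have \<rho>0: "0 < \<rho>0" "\<rho>0 < \<rho>1" "\<rho>0 < \<rho>2" "\<rho>0 < \<eta> / 2" using \<rho>1 \<rho>2 \<eta> by (auto simp: \<rho>0_def)
  show thesis
  \<comment> \<open>Proximity is assumed coordinatewise, so by the l1 bound on the norm each
    coordinate receives an equal share of \<open>\<rho>0\<close>.\<close>
  proof (rule that[of "\<rho>0 / real CARD('n)" k])
    show "0 < \<rho>0 / real CARD('n)" using \<rho>0 by simp
    fix y :: "real^'n"
    assume yk: "y $ k = 0" and y: "\<And>i. i \<noteq> k \<Longrightarrow> \<bar>y $ i - p $ i\<bar> \<le> \<rho>0 / real CARD('n)"
    \<comment> \<open>\<open>y\<close> has height 0 along \<open>e\<close>; the segment has to be
      centred at the height of \<open>p\<close>.\<close>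
    define y0 where "y0 = y + (p $ k) *\<^sub>R e"
    have "norm (y0 - p) \<le> (\<Sum>i\<in>UNIV. \<bar>(y0 - p) $ i\<bar>)" by (rule norm_le_l1_cart)
    also have "\<dots> \<le> (\<Sum>i\<in>(UNIV::'n set). \<rho>0 / real CARD('n))"
    proof (rule sum_mono)
      fix i show "\<bar>(y0 - p) $ i\<bar> \<le> \<rho>0 / real CARD('n)"
        using y[of i] yk \<rho>0 by (cases "i = k") (auto simp: y0_def e_def axis_def)
    qed
    also have "\<dots> = \<rho>0" by simp
    finally have y0: "norm (y0 - p) \<le> \<rho>0" .
    have y0U: "y0 + s *\<^sub>R e \<in> U" if "s \<in> {-l..l}" for s
    proof -
      have "norm (y0 + s *\<^sub>R e - p) \<le> norm (y0 - p) + norm (s *\<^sub>R e)"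
        using norm_triangle_ineq[of "y0 - p" "s *\<^sub>R e"] by (simp add: algebra_simps)
      also have "\<dots> < \<eta>" using y0 \<rho>0 l that e1 by auto
      finally have "y0 + s *\<^sub>R e \<in> ball p \<eta>" by (simp add: dist_norm norm_minus_commute)
      then show ?thesis using \<eta> by blast
    qed
    have "continuous_on {-l..l} (\<lambda>s. \<xi> (y0 + s *\<^sub>R e))"
      by (rule continuous_on_compose2[OF c\<xi>]) (auto intro!: continuous_intros y0U)
    moreover have "\<xi> (y0 + (-l) *\<^sub>R e) \<le> 0" "0 \<le> \<xi> (y0 + l *\<^sub>R e)"
      using \<rho>1(2)[of "y0 + l *\<^sub>R e"] \<rho>2(2)[of "y0 + (-l) *\<^sub>R e"] y0 \<rho>0 by (auto simp: dist_norm)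
    ultimately obtain s where s: "s \<in> {-l..l}" "\<xi> (y0 + s *\<^sub>R e) = 0"
      using IVT'[of "\<lambda>s. \<xi> (y0 + s *\<^sub>R e)" "-l" 0 l] l by auto
    then have "\<phi> (y0 + s *\<^sub>R e) = 0" using d0 by (auto simp: \<xi>_def sgn_zero_iff)
    then have "y0 + s *\<^sub>R e \<in> S" using U(5) y0U[OF s(1)] by blast
    then have "y + (p $ k + s) *\<^sub>R axis k 1 \<in> S" by (simp add: y0_def e_def scaleR_add_left add.assoc)
    then show "\<exists>s. y + s *\<^sub>R axis k 1 \<in> S" by blast
  qed
qed

section \<open>Assembling the perturbation over lattice columns\<close>

text \<open>By the mean value theorem, since the cosine is at least 1/2 on \<open>[-1, 1]\<close>,
  as \<open>1 < pi / 3\<close>. Thus the sine tilt separates points as well as a linear one, up to a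
  factor 2.\<close>

lemma sin_diff_bounds:
  fixes x y :: real
  assumes "\<bar>x\<bar> \<le> 1" "\<bar>y\<bar> \<le> 1"
  shows "\<bar>x - y\<bar> / 2 \<le> \<bar>sin x - sin y\<bar>" "\<bar>sin x - sin y\<bar> \<le> \<bar>x - y\<bar>"
proof -
  have main: "(v - u) / 2 \<le> sin v - sin u \<and> sin v - sin u \<le> v - u" if uv: "u < v" "\<bar>u\<bar> \<le> 1" "\<bar>v\<bar> \<le> 1" for u v :: real
  proof -
    obtain z where z: "u < z" "z < v" "sin v - sin u = (v - u) * cos z"
      using MVT2[OF uv(1), of sin cos] by (auto intro: DERIV_sin)
    have "cos (pi / 3) \<le> cos \<bar>z\<bar>"
      using z that pi_gt3 by (intro cos_monotone_0_pi_le) auto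
    then have "1 / 2 \<le> cos z" by (simp add: cos_60)
    then have "(v - u) * (1 / 2) \<le> (v - u) * cos z" "(v - u) * cos z \<le> (v - u) * 1"
      using that by (intro mult_left_mono; simp)+
    then show ?thesis using z by simp
  qed
  show "\<bar>x - y\<bar> / 2 \<le> \<bar>sin x - sin y\<bar>" "\<bar>sin x - sin y\<bar> \<le> \<bar>x - y\<bar>"
    using main[of x y] main[of y x] assms by (cases x y rule: linorder_cases; force)+
qed

lemma card_int_interval_ge:
  fixes c \<rho> R :: real
  assumes "1 \<le> \<rho> * R"
  shows "\<rho> * R \<le> real (card {\<lceil>R * (c - \<rho>)\<rceil>..\<lfloor>R * (c + \<rho>)\<rfloor>})"
proof -
  have "R * (c + \<rho>) - R * (c - \<rho>) = 2 * (\<rho> * R)" by (simp add: algebra_simps)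
  then have "\<rho> * R \<le> real_of_int (\<lfloor>R * (c + \<rho>)\<rfloor> + 1 - \<lceil>R * (c - \<rho>)\<rceil>)"
    using assms by (simp, linarith)
  then show ?thesis by simp
qed

text \<open>The first condition on \<open>q\<close> pays for the averaging. The second says that a
  hit, at distance at most \<open>1 / (q * R)\<close> from the lattice, is within reach of a bump of
  radius \<open>L / (2 * R)\<close>. Shift, tilt and bumps each take at most
  \<open>\<epsilon> / 8\<close> of the allowed perturbation.\<close>

lemma exists_perturbation_through_lattice:
  fixes S :: "(real^'n) set" and k :: 'n and L q :: nat
  assumes S: "c2_hypersurface S" and \<rho>: "0 < \<rho>" "\<rho> \<le> 1"
    and vert: "\<And>y. \<lbrakk>y $ k = 0; \<And>i. i \<noteq> k \<Longrightarrow> \<bar>y $ i - p $ i\<bar> \<le> \<rho>\<rbrakk> \<Longrightarrow> \<exists>s. y + s *\<^sub>R axis k 1 \<in> S"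
    and \<epsilon>: "0 < \<epsilon>" and \<epsilon>0: "0 < \<epsilon>0" "\<epsilon>0 \<le> 1" "real (CARD('n) - 1) * \<epsilon>0 \<le> \<epsilon> / 8"
    and R: "1 \<le> R" "8 \<le> \<epsilon> * R" "1 \<le> \<rho> * R"
    and L: "1 \<le> L" "real L \<le> 2 * R"
    and q: "72 * (2 * real L + 1) ^ (CARD('n) - 1) \<le> real q * \<epsilon>0" "960 * R \<le> \<epsilon> * real q * (real L)\<^sup>2"
  shows "\<exists>S'. c2_hypersurface S' \<and> c2_close S S' \<epsilon> \<and>
       (\<exists>P. finite P \<and> P \<subseteq> S' \<inter> scaled_lattice R \<and>
            (\<rho> * R) ^ (CARD('n) - 1) \<le> 2 * real q * real (card P))"
proof -
  define I where "I = UNIV - {k}"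
  have I: "finite I" "card I = CARD('n) - 1" by (auto simp: I_def card_Diff_singleton)
  define e :: "real^'n" where "e = axis k 1"
  have e1: "norm e = 1" by (simp add: e_def)
  \<comment> \<open>Vertical lines through lattice points near \<open>p\<close> are labelled by the
    integer numerators of their horizontal coordinates.\<close>
  define A where "A = PiE I (\<lambda>i. {\<lceil>R * (p $ i - \<rho>)\<rceil>..\<lfloor>R * (p $ i + \<rho>)\<rfloor>})"
  have A: "finite A" "A \<subseteq> extensional I" unfolding A_def using I by (auto intro!: finite_PiE simp: PiE_iff)
  have cardA: "(\<rho> * R) ^ (CARD('n) - 1) \<le> real (card A)"
  proof -
    have "(\<rho> * R) ^ card I = (\<Prod>i\<in>I. \<rho> * R)" by simp
    also have "\<dots> \<le> (\<Prod>i\<in>I. real (card {\<lceil>R * (p $ i - \<rho>)\<rceil>..\<lfloor>R * (p $ i + \<rho>)\<rfloor>}))"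
      using R \<rho> card_int_interval_ge[OF R(3)] by (intro prod_mono) auto
    also have "\<dots> = real (card A)" using I by (simp add: A_def card_PiE)
    finally show ?thesis using I by simp
  qed
  have near: "\<bar>real_of_int (a i) / R - p $ i\<bar> \<le> \<rho>" if "a \<in> A" "i \<in> I" for a i
  proof -
    have "a i \<in> {\<lceil>R * (p $ i - \<rho>)\<rceil>..\<lfloor>R * (p $ i + \<rho>)\<rfloor>}" using that by (auto simp: A_def)
    then have "R * (p $ i - \<rho>) \<le> a i" "a i \<le> R * (p $ i + \<rho>)" by (auto simp: ceiling_le_iff le_floor_iff)
    then have "p $ i - \<rho> \<le> a i / R" "a i / R \<le> p $ i + \<rho>" using R(1) by (auto simp: field_simps)
    then show ?thesis by linarith
  qed
  define Y :: "('n \<Rightarrow> int) \<Rightarrow> real^'n" where "Y = (\<lambda>a. \<chi> i. if i = k then 0 else real_of_int (a i) / R)"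
  have Yk: "Y a $ k = 0" "Y a \<bullet> e = 0" for a by (auto simp: Y_def e_def inner_axis)
  have Yi: "Y a $ i = real_of_int (a i) / R" if "i \<in> I" for a i using that by (auto simp: Y_def I_def)
  have "\<exists>s. Y a + s *\<^sub>R e \<in> S" if "a \<in> A" for a
    unfolding e_def using near[OF that] by (intro vert) (auto simp: Yk Yi I_def)
  then obtain f where f: "\<And>a. a \<in> A \<Longrightarrow> Y a + f a *\<^sub>R e \<in> S" by metis
  \<comment> \<open>The factor \<open>R\<close> expresses the tilt in lattice units:
    \<open>\<theta>\<close> then distorts differences of integer labels by at most a factor
    2.\<close>
  define \<theta> where "\<theta> = (\<lambda>i (a::int). R * sin (a / R - p $ i))"
  have \<theta>: "1/2 \<le> \<bar>\<theta> i (a i) - \<theta> i (b i)\<bar> \<and> \<bar>\<theta> i (a i) - \<theta> i (b i)\<bar> \<le> real L"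
    if ab: "a \<in> A" "b \<in> A" "i \<in> I" "\<bar>a i - b i\<bar> \<le> int L" "a i \<noteq> b i" for a b i
  proof -
    define x y where "x = a i / R - p $ i" and "y = b i / R - p $ i"
    have "\<bar>x\<bar> \<le> 1" "\<bar>y\<bar> \<le> 1" using near ab \<rho> unfolding x_def y_def by force+
    note sb = sin_diff_bounds[OF this]
    have xy: "R * \<bar>x - y\<bar> = \<bar>a i - b i\<bar>"
      using R(1) by (simp add: x_def y_def abs_divide flip: diff_divide_distrib of_int_diff)
    have "\<bar>\<theta> i (a i) - \<theta> i (b i)\<bar> = R * \<bar>sin x - sin y\<bar>"
      using R(1) by (simp add: \<theta>_def x_def y_def abs_mult flip: right_diff_distrib)
    moreover have "R * (\<bar>x - y\<bar> / 2) \<le> R * \<bar>sin x - sin y\<bar>" "R * \<bar>sin x - sin y\<bar> \<le> R * \<bar>x - y\<bar>"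
      using sb R(1) by (intro mult_left_mono; simp)+
    moreover have "1 \<le> \<bar>a i - b i\<bar>" using ab by linarith
    ultimately show ?thesis using xy ab(4) by (simp flip: of_int_abs)
  qed
  \<comment> \<open>Heights are also multiplied by \<open>R\<close>, so being near a lattice point
    means being near an integer.\<close>
  obtain X \<tau> t where X: "X \<subseteq> A" "\<And>i. 0 \<le> \<tau> i \<and> \<tau> i \<le> \<epsilon>0" "0 \<le> t" "t \<le> 1"
    and hit: "\<And>a. a \<in> X \<Longrightarrow> \<exists>N::int. \<bar>R * f a + t + (\<Sum>i\<in>I. \<tau> i * \<theta> i (a i)) - N\<bar> \<le> 1 / real q"
    and sep: "\<And>a b. \<lbrakk>a \<in> X; b \<in> X; a \<noteq> b\<rbrakk> \<Longrightarrow> \<exists>i\<in>I. \<bar>a i - b i\<bar> > int L"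
    and cardX: "real (card A) \<le> 2 * real q * real (card X)"
  proof (rule exists_separated_points_near_int[where F = "\<lambda>a. R * f a" and q = q and \<theta> = \<theta>, OF I(1) A _ \<epsilon>0(1,2) L(1)])
    show "72 * (2 * real L + 1) ^ card I \<le> real q * \<epsilon>0" using q(1) I by simp
  qed (use \<theta> that in \<open>blast+\<close>)
  obtain N where N: "\<And>a. a \<in> X \<Longrightarrow> \<bar>R * f a + t + (\<Sum>i\<in>I. \<tau> i * \<theta> i (a i)) - of_int (N a)\<bar> \<le> 1 / real q"
    using hit by metis
  have finX: "finite X" using X(1) A(1) finite_subset by blast
  have q0: "0 < real q"
    using q(1) \<epsilon>0 one_le_power[of "2 * real L + 1" "CARD('n) - 1"]
    by (smt (verit) mult_nonneg_nonneg of_nat_0_le_iff mult_eq_0_iff)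
  \<comment> \<open>Labels more than \<open>L\<close> apart give base points more than
    \<open>L / R\<close> apart, so half of that is a possible bump radius.\<close>
  define r where "r = real L / (2 * R)"
  have r: "0 < r" "r \<le> 1" using L R by (auto simp: r_def)
  have sepY: "2 * r \<le> norm (Y a - Y b)" if ab: "a \<in> X" "b \<in> X" "a \<noteq> b" for a b
  proof -
    obtain i where i: "i \<in> I" "\<bar>a i - b i\<bar> > int L" using sep ab by blast
    have "real L \<le> \<bar>real_of_int (a i) - b i\<bar>" using i(2) by linarith
    then have "2 * r \<le> \<bar>real_of_int (a i) - b i\<bar> / R" using R by (simp add: r_def divide_right_mono)
    also have "\<dots> = \<bar>(Y a - Y b) $ i\<bar>"
      using R i by (simp add: Yi abs_divide flip: diff_divide_distrib)
    also have "\<dots> \<le> norm (Y a - Y b)" by (rule component_le_norm_cart)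
    finally show ?thesis .
  qed
  have injY: "inj_on Y X"
  proof (rule inj_onI, rule ccontr)
    fix a b assume "a \<in> X" "b \<in> X" "Y a = Y b" "a \<noteq> b"
    then show False using sepY[of a b] r by simp
  qed
  \<comment> \<open>This is the vertical displacement still missing after shift and tilt. It is
    transported from labels to base points next, since bumps are indexed by points of space.\<close>
  define \<sigma>0 where "\<sigma>0 = (\<lambda>a. (of_int (N a) - (R * f a + t + (\<Sum>i\<in>I. \<tau> i * \<theta> i (a i)))) / R)"
  define \<sigma> where "\<sigma> = \<sigma>0 \<circ> inv_into X Y"
  have \<sigma>Y: "\<sigma> (Y a) = \<sigma>0 a" if "a \<in> X" for a using injY that by (simp add: \<sigma>_def)
  have \<sigma>le: "\<bar>\<sigma> z\<bar> \<le> \<epsilon> / 240 * r\<^sup>2" if z: "z \<in> Y ` X" for z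
  proof -
    obtain a where a: "a \<in> X" "z = Y a" using z by blast
    have "\<bar>\<sigma> z\<bar> = \<bar>R * f a + t + (\<Sum>i\<in>I. \<tau> i * \<theta> i (a i)) - of_int (N a)\<bar> / R"
      using R(1) \<sigma>Y[OF a(1)] by (simp add: a \<sigma>0_def abs_divide abs_minus_commute)
    also have "\<dots> \<le> 1 / real q / R" using N[OF a(1)] R(1) by (intro divide_right_mono) auto
    also have "\<dots> \<le> \<epsilon> / 240 * r\<^sup>2"
      using q(2) q0 R(1) by (simp add: r_def power2_eq_square field_simps)
    finally show ?thesis .
  qed
  obtain \<psi> where \<psi>: "C2_bounded \<psi> (30 * (\<epsilon> / 240))" "\<And>z. z \<in> Y ` X \<Longrightarrow> \<psi> z = \<sigma> z" "\<And>x s. \<psi> (x + s *\<^sub>R e) = \<psi> x"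
  proof (rule exists_C2_bounded_interpolation[OF e1 _ _ _ r \<sigma>le])
    show "2 * r \<le> norm (z - z')" if "z \<in> Y ` X" "z' \<in> Y ` X" "z \<noteq> z'" for z z'
      using that sepY by blast
  qed (use finX Yk \<epsilon> that in auto)
  define \<Psi> where "\<Psi> = (\<lambda>x. t / R + (\<Sum>i\<in>I. \<tau> i * sin (x \<bullet> axis i 1 - p $ i)) + \<psi> x)"
  define \<delta> where "\<delta> = \<epsilon> / 8 + real (card I) * \<epsilon>0 + 30 * (\<epsilon> / 240)"
  have "t / R \<le> 1 / R" using X R by (intro divide_right_mono) auto
  also have "\<dots> \<le> \<epsilon> / 8" using R \<epsilon> by (simp add: field_simps)
  finally have "\<bar>t / R\<bar> \<le> \<epsilon> / 8" using X R by simp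
  then have \<Psi>: "C2_bounded \<Psi> \<delta>"
    unfolding \<Psi>_def \<delta>_def using X(2)
    by (intro C2_bounded_add C2_bounded_const C2_bounded_sum C2_bounded_sin \<psi> I) auto
  have \<delta>: "\<delta> < \<epsilon>" using \<epsilon>0(3) \<epsilon> by (simp add: \<delta>_def I)
  have inv: "\<Psi> (x + s *\<^sub>R e) = \<Psi> x" for x s
  proof -
    have "(x + s *\<^sub>R e) \<bullet> axis i 1 = x \<bullet> axis i 1" if "i \<in> I" for i
      using that by (simp add: inner_axis e_def I_def) (simp add: axis_def)
    then show ?thesis by (simp add: \<Psi>_def \<psi>(3))
  qed
  define g where "g = (\<lambda>x. x + \<Psi> x *\<^sub>R e)"
  define P where "P = (\<lambda>a. Y a + (of_int (N a) / R) *\<^sub>R e) ` X"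
  have gP: "g (Y a + f a *\<^sub>R e) = Y a + (of_int (N a) / R) *\<^sub>R e" if a: "a \<in> X" for a
  proof -
    have "\<Psi> (Y a + f a *\<^sub>R e) = t / R + (\<Sum>i\<in>I. \<tau> i * sin (a i / R - p $ i)) + \<sigma>0 a"
      using a \<psi>(2)[of "Y a"] \<sigma>Y[OF a] by (simp add: inv) (simp add: \<Psi>_def inner_axis Yi)
    also have "(\<Sum>i\<in>I. \<tau> i * sin (a i / R - p $ i)) = (\<Sum>i\<in>I. \<tau> i * \<theta> i (a i)) / R"
      using R(1) by (simp add: \<theta>_def sum_divide_distrib)
    finally have "f a + \<Psi> (Y a + f a *\<^sub>R e) = of_int (N a) / R"
      using R(1) by (simp add: \<sigma>0_def diff_divide_distrib add_divide_distrib)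
    then show ?thesis by (simp add: g_def add.assoc flip: scaleR_add_left)
  qed
  have "P \<subseteq> g ` S \<inter> scaled_lattice R"
  proof
    fix x assume "x \<in> P"
    then obtain a where a: "a \<in> X" "x = Y a + (of_int (N a) / R) *\<^sub>R e" by (auto simp: P_def)
    have "x \<in> g ` S" using gP[OF a(1)] f X(1) a by (metis imageI subsetD)
    moreover have "R * x $ i \<in> \<int>" for i
      using R(1) by (cases "i = k") (auto simp: a Y_def e_def axis_def)
    ultimately show "x \<in> g ` S \<inter> scaled_lattice R" by (auto simp: scaled_lattice_def)
  qed
  moreover have "card P = card X"
    unfolding P_def
  proof (rule card_image, rule inj_onI)
    fix a b assume ab: "a \<in> X" "b \<in> X" and eq: "Y a + (of_int (N a) / R) *\<^sub>R e = Y b + (of_int (N b) / R) *\<^sub>R e"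
    have "Y a $ i = Y b $ i" for i
      using arg_cong[OF eq, of "\<lambda>v. v $ i"] Yk by (cases "i = k") (auto simp: e_def axis_def)
    then have "Y a = Y b" by (simp add: vec_eq_iff)
    then show "a = b" using injY ab by (simp add: inj_on_eq_iff)
  qed
  moreover have "finite P" using finX by (simp add: P_def)
  ultimately show ?thesis
    using c2_close_shear[OF S e1 \<Psi> \<delta> inv] cardA cardX
    by (intro exI[of _ "g ` S"] conjI exI[of _ P]) (auto simp: g_def)
qed

section \<open>Choice of the scales\<close>

theorem theorem6p1:
  fixes S :: "(real^'n) set" and \<epsilon> :: real
  assumes "CARD('n) \<ge> 2" and "c2_hypersurface S" and "S \<noteq> {}" and "\<epsilon> > 0"
  shows "\<exists>C c. C > 0 \<and> c > 0 \<and>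
    (\<forall>R\<ge>C. \<exists>S'. c2_hypersurface S' \<and> c2_close S S' \<epsilon> \<and>
       (\<exists>P. finite P \<and> P \<subseteq> S' \<inter> scaled_lattice R \<and>
            real (card P) \<ge> c * R powr (real CARD('n) - 2 + 2 / (real CARD('n) + 1))))"
proof -
  define n where "n = CARD('n)"
  define m where "m = n - 1"
  have nm: "n = m + 1" "1 \<le> m" using assms(1) by (auto simp: m_def n_def)
  obtain p where "p \<in> S" using assms(3) by blast
  obtain k \<rho>' where \<rho>': "0 < \<rho>'"
    "\<And>y. \<lbrakk>y $ k = 0; \<And>i. i \<noteq> k \<Longrightarrow> \<bar>y $ i - p $ i\<bar> \<le> \<rho>'\<rbrakk> \<Longrightarrow> \<exists>s. y + s *\<^sub>R axis k 1 \<in> S"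
    using c2_hypersurface_vertical_point[OF assms(2) \<open>p \<in> S\<close>] by metis
  define \<rho> where "\<rho> = min \<rho>' 1"
  have \<rho>: "0 < \<rho>" "\<rho> \<le> 1" using \<rho>' by (auto simp: \<rho>_def)
  have vert: "\<exists>s. y + s *\<^sub>R axis k 1 \<in> S" if "y $ k = 0" "\<And>i. i \<noteq> k \<Longrightarrow> \<bar>y $ i - p $ i\<bar> \<le> \<rho>" for y
    using that by (intro \<rho>'(2)) (auto simp: \<rho>_def)
  define \<epsilon>0 where "\<epsilon>0 = min 1 (\<epsilon> / (8 * real n))"
  have \<epsilon>0: "0 < \<epsilon>0" "\<epsilon>0 \<le> 1" using assms(4) nm by (auto simp: \<epsilon>0_def)
  have \<epsilon>0m: "real m * \<epsilon>0 \<le> \<epsilon> / 8"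
  proof -
    have "real m * \<epsilon>0 \<le> real n * (\<epsilon> / (8 * real n))"
      using \<epsilon>0 nm by (intro mult_mono) (auto simp: \<epsilon>0_def)
    moreover have "0 < n" using nm by simp
    ultimately show ?thesis by simp
  qed
  \<comment> \<open>One summand serves each of the two conditions on \<open>q\<close>, once
    \<open>q\<close> is at least \<open>K * L ^ m\<close>.\<close>
  define K where "K = 72 * 3 ^ m / \<epsilon>0 + 960 / \<epsilon>"
  have K: "0 < K" "72 * 3 ^ m \<le> K * \<epsilon>0" "960 \<le> \<epsilon> * K"
    using \<epsilon>0(1) assms(4) by (auto simp: K_def distrib_left distrib_right add_pos_pos)
  define C where "C = 1 + 8 / \<epsilon> + 1 / \<rho>"
  \<comment> \<open>The denominator comes from \<open>2 * q \<le> 2 * (K + 1) * L ^ m\<close> and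
    \<open>L \<le> 2 * w\<close>.\<close>
  define c where "c = \<rho> ^ m / (2 * (K + 1) * 2 ^ m)"
  have C: "0 < C" using \<rho> assms(4) by (simp add: C_def add_pos_pos)
  have c: "0 < c" using \<rho> K by (simp add: c_def)
  have "\<exists>S'. c2_hypersurface S' \<and> c2_close S S' \<epsilon> \<and>
       (\<exists>P. finite P \<and> P \<subseteq> S' \<inter> scaled_lattice R \<and>
            real (card P) \<ge> c * R powr (real n - 2 + 2 / (real n + 1)))" if RC: "R \<ge> C" for R
  proof -
    have "0 \<le> 8 / \<epsilon>" "0 \<le> 1 / \<rho>" using \<rho> assms(4) by auto
    then have "1 \<le> R" "8 / \<epsilon> \<le> R" "1 / \<rho> \<le> R" using RC unfolding C_def by linarith+
    then have R: "1 \<le> R" "8 \<le> \<epsilon> * R" "1 \<le> \<rho> * R" using \<rho> assms(4) by (auto simp: field_simps)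
    \<comment> \<open>The averaging needs \<open>q\<close> of order \<open>L ^ (n - 1)\<close>, and
      the bumps need \<open>q * L\<^sup>2\<close> of order at least \<open>R\<close>. The smallest
      \<open>L\<close> meeting both is of order \<open>R powr (1 / (n + 1))\<close>, which makes
      \<open>L / R\<close> of order \<open>R powr (- n / (n + 1))\<close>.\<close>
    define w where "w = R powr (1 / (real n + 1))"
    have w1: "1 \<le> w" using R(1) by (simp add: w_def ge_one_powr_ge_zero)
    have wR: "w \<le> R" using R(1) powr_mono[of "1 / (real n + 1)" 1 R] by (simp add: w_def)
    have wpow: "w ^ j = R powr (real j / (real n + 1))" for j
      using R(1) by (simp add: w_def powr_powr flip: powr_realpow)
    have wn: "w ^ (n + 1) = R" using R(1) unfolding wpow by (simp add: add.commute)
    define L where "L = nat \<lceil>w\<rceil>"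
    have L: "w \<le> real L" "real L \<le> 2 * w" "1 \<le> real L"
      unfolding L_def using w1 by linarith+
    define q where "q = nat \<lceil>K * real L ^ m\<rceil>"
    have Lm: "1 \<le> real L ^ m" using L(3) by (rule one_le_power)
    have "0 \<le> K * real L ^ m" using K by simp
    then have q: "K * real L ^ m \<le> real q" "real q \<le> K * real L ^ m + 1"
      unfolding q_def by linarith+
    have q1: "72 * (2 * real L + 1) ^ m \<le> real q * \<epsilon>0"
    proof -
      have "(2 * real L + 1) ^ m \<le> (3 * real L) ^ m" using L(3) by (intro power_mono) auto
      then have "72 * (2 * real L + 1) ^ m \<le> (72 * 3 ^ m) * real L ^ m" by (simp add: power_mult_distrib)
      also have "\<dots> \<le> (K * \<epsilon>0) * real L ^ m" using K Lm by (intro mult_right_mono) auto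
      also have "\<dots> = (K * real L ^ m) * \<epsilon>0" by simp
      also have "\<dots> \<le> real q * \<epsilon>0" using q \<epsilon>0 by (intro mult_right_mono) auto
      finally show ?thesis .
    qed
    have q2: "960 * R \<le> \<epsilon> * real q * (real L)\<^sup>2"
    proof -
      have "R \<le> real L ^ (n + 1)" unfolding wn[symmetric] using L(1) w1 by (intro power_mono) auto
      then have "960 * R \<le> (\<epsilon> * K) * real L ^ (n + 1)" using K(3) R(1) by (intro mult_mono) auto
      also have "\<dots> = \<epsilon> * (K * real L ^ m) * (real L)\<^sup>2"
        by (simp add: nm power2_eq_square)
      also have "\<dots> \<le> \<epsilon> * real q * (real L)\<^sup>2"
        using q(1) assms(4) by (intro mult_right_mono mult_left_mono) auto
      finally show ?thesis .
    qed
    have LR: "1 \<le> L" "real L \<le> 2 * R" using L wR by auto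
    have "\<exists>S'. c2_hypersurface S' \<and> c2_close S S' \<epsilon> \<and>
       (\<exists>P. finite P \<and> P \<subseteq> S' \<inter> scaled_lattice R \<and> (\<rho> * R) ^ m \<le> 2 * real q * real (card P))"
      unfolding m_def n_def
      by (rule exists_perturbation_through_lattice[where k = k and p = p,
          OF assms(2) \<rho> _ assms(4) \<epsilon>0 \<epsilon>0m[unfolded m_def n_def] R LR q1[unfolded m_def n_def] q2])
        (rule vert)
    then obtain S' P where S': "c2_hypersurface S'" "c2_close S S' \<epsilon>" "finite P"
      "P \<subseteq> S' \<inter> scaled_lattice R" "(\<rho> * R) ^ m \<le> 2 * real q * real (card P)" by blast
    have "2 * real q \<le> 2 * (K + 1) * 2 ^ m * w ^ m"
    proof -
      have "real q \<le> (K + 1) * real L ^ m" using q(2) Lm by (simp add: distrib_right)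
      also have "\<dots> \<le> (K + 1) * (2 * w) ^ m" using L K by (intro mult_left_mono power_mono) auto
      finally show ?thesis by (simp add: power_mult_distrib algebra_simps)
    qed
    then have "(\<rho> * R) ^ m \<le> 2 * (K + 1) * 2 ^ m * w ^ m * real (card P)"
      using S'(5) by (meson mult_right_mono of_nat_0_le_iff order_trans)
    then have "\<rho> ^ m * R ^ m / (2 * (K + 1) * 2 ^ m * w ^ m) \<le> real (card P)"
      using K w1 by (simp add: pos_divide_le_eq power_mult_distrib mult.commute)
    \<comment> \<open>About \<open>R ^ m\<close> columns divided by \<open>q\<close>, of order
      \<open>w ^ m\<close>, yields the exponent \<open>n * (n - 1) / (n + 1)\<close>, which is the
      claimed one rewritten.\<close>
    moreover have "R ^ m / w ^ m = R powr (real n - 2 + 2 / (real n + 1))"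
    proof -
      have "R ^ m / w ^ m = R powr (real m - real m / (real n + 1))"
        unfolding wpow using R(1) by (simp add: powr_diff powr_realpow)
      also have "real m - real m / (real n + 1) = real n - 2 + 2 / (real n + 1)"
        by (simp add: nm field_simps)
      finally show ?thesis .
    qed
    moreover have "c * (R ^ m / w ^ m) = \<rho> ^ m * R ^ m / (2 * (K + 1) * 2 ^ m * w ^ m)"
      unfolding c_def by (simp only: times_divide_times_eq)
    ultimately have "c * R powr (real n - 2 + 2 / (real n + 1)) \<le> real (card P)" by simp
    then show ?thesis using S' by blast
  qed
  then show ?thesis using C c unfolding n_def by blast
qed

end
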